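(* Let $H$ be a simple finite graph (loops allowed) without isolated vertices that is not a complete looped graph. Then $H$ is either of complete bipartite type or of complete type. Moreover, $H$ is of complete bipartite type exactly under the following conditions (one of them holding): (1) $H$ is loopless; (2) $a(H)^2 < \eta(H)$; (3) $a(H)^2 = \eta(H)$, $m(H) >1$ and $m(H) \geq n(H)^2$; (4) $a(H)^2 = \eta(H)$, $m(H) = n(H) = 1$ and $a(H)a'(H) < \eta'(H)$; (5) $a(H)^2 = \eta(H)$, $m(H) = n(H) = 1$, $a(H)a'(H) = \eta'(H)$, $b'(H)=0$, $2n'(H)a'(H) \leq a(H)m'(H)$ and $m'(H)>0$. And $H$ is of complete type exactly under the following conditions (one of them holding): (1) $a(H)^2 = \eta(H)$ and $m(H) < n(H)^2$; (2) $a(H)^2 = \eta(H)$, $m(H) = n(H) = 1$ and $a(H)a'(H) > \eta'(H)$; (3) $a(H)^2 = \eta(H)$, $m(H) = n(H) = 1$, $a(H)a'(H) = \eta'(H)$ and $b'(H)>0$; (4) $a(H)^2 = \eta(H)$, $m(H) = n(H) = 1$, $a(H)a'(H) = \eta'(H)$, $b'(H)=0$ and $2n'(H)a'(H) > a(H)m'(H)$.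
   Context: $\mathrm{hom}(G,H)$ is the number of maps $f:V(G)\to V(H)$ with $uv\in E(G)\Rightarrow f(u)f(v)\in E(H)$; $K_{d,d}$ is the complete bipartite graph with $d$ vertices per class and $K_{d+1}$ the complete loopless graph on $d+1$ vertices. A complete looped graph is one in which all pairs of distinct vertices are adjacent and every vertex has a loop. $H$ is of complete bipartite type if there is $d(H)>0$ such that for all $d\ge d(H)$, $\mathrm{hom}(K_{d+1},H)^{1/(d+1)} < \mathrm{hom}(K_{d,d},H)^{1/2d}$; of complete type if there is $d(H)>0$ such that for all $d\ge d(H)$, $\mathrm{hom}(K_{d,d},H)^{1/2d} < \mathrm{hom}(K_{d+1},H)^{1/(d+1)}$. A complete bipartite image is an ordered pair $(A,B)$ of nonempty subsets of $V(H)$ with $ab\in E(H)$ for all $a\in A$, $b\in B$; its size is $|A||B|$. $\eta(H)$ is the maximal size of a complete bipartite image, and $m(H)$ the number of complete bipartite images of size $\eta(H)$. For $H$ with at least one loop: a complete image is an ordered pair $(A,B)$ of disjoint subsets of $V(H)$ with $A\neq\emptyset$ ($B$ may be empty), such that $A$ induces a complete looped graph, $B$ induces a complete loopless graph, and $ab\in E(H)$ for all $a\in A$, $b\in B$; its primary size is $|A|$ and secondary size $|B|$. $a(H)$ is the maximal primary size of a complete image; $b(H)$ is the maximal secondary size of a complete image of primary size $a(H)$; $n(H)$ is the number of complete images of primary size $a(H)$ and secondary size $b(H)$. When $a(H)^2=\eta(H)$ and $m(H)=n(H)=1$, there is a set $A_0\subseteq V(H)$ with $|A_0|=a(H)$ such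 that $(A_0,\emptyset)$ is the unique complete image of primary size $a(H)$ and $(A_0,A_0)$ is the unique complete bipartite image of size $\eta(H)$. Then: $a'(H)$ is the largest primary size of a complete image $(A',B')$ with $A'\cup B'\not\subseteq A_0$ ($a'(H)=0$ if there is none); $b'(H)$ is the largest secondary size of such a complete image of primary size $a'(H)$; $n'(H)$ is the number of such complete images with primary size $a'(H)$ and secondary size $b'(H)$. $\eta'(H)$ is the maximum size of a complete bipartite image $(A',B')$ with $A'\not\subseteq A_0$ or $B'\not\subseteq A_0$ ($\eta'(H)=0$ if there is none), and $m'(H)$ is the number of such complete bipartite images of size $\eta'(H)$. *)

theory Defs
  imports Complex_Main "HOL-Library.FuncSet" "Graph_Theory.Graph_Theory"
begin

text \<open>
  A finite simple graph with loops allowed is a \<^locale>\<open>pair_pseudo_graph\<close>: finitely many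
  vertices and a symmetric arc relation on them; an undirected edge is a pair of opposite arcs
  and a loop at a vertex \<open>v\<close> is the arc \<open>(v, v)\<close>.
\<close>

definition has_loop :: "'a pair_pre_digraph \<Rightarrow> bool" where
  "has_loop H \<longleftrightarrow> (\<exists>v\<in>pverts H. (v, v) \<in> parcs H)"

text \<open>A vertex whose only incident edge is a loop does not count as isolated.\<close>

definition isolated_vertex :: "'a pair_pre_digraph \<Rightarrow> 'a \<Rightarrow> bool" where
  "isolated_vertex H v \<longleftrightarrow> v \<in> pverts H \<and> \<not> (\<exists>u\<in>pverts H. (v, u) \<in> parcs H)"

text \<open>The graph without vertices is vacuously a complete looped graph.\<close>

definition complete_looped :: "('a, 'b) pre_digraph \<Rightarrow> bool" where
  "complete_looped G \<longleftrightarrow>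
     (\<forall>u\<in>verts G. \<forall>v\<in>verts G. u \<noteq> v \<longrightarrow> u \<rightarrow>\<^bsub>G\<^esub> v) \<and> (\<forall>v\<in>verts G. v \<rightarrow>\<^bsub>G\<^esub> v)"


subsection \<open>Homomorphism counts and the two types\<close>

definition hom_count :: "'a pair_pre_digraph \<Rightarrow> 'b pair_pre_digraph \<Rightarrow> nat" where
  "hom_count G H =
     card {f \<in> pverts G \<rightarrow>\<^sub>E pverts H. \<forall>u v. (u, v) \<in> parcs G \<longrightarrow> (f u, f v) \<in> parcs H}"

definition Kcomplete :: "nat \<Rightarrow> nat pair_pre_digraph" where
  "Kcomplete n = \<lparr> pverts = {..<n}, parcs = {(i, j). i < n \<and> j < n \<and> i \<noteq> j} \<rparr>"

definition Kbipartite :: "nat \<Rightarrow> (nat + nat) pair_pre_digraph" where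
  "Kbipartite d =
     \<lparr> pverts = {..<d} <+> {..<d},
       parcs = Inl ` {..<d} \<times> Inr ` {..<d} \<union> Inr ` {..<d} \<times> Inl ` {..<d} \<rparr>"

lemma complete_digraph_Kcomplete: "K\<^bsub>n\<^esub> (with_proj (Kcomplete n))"
  unfolding complete_digraph_pair_def Kcomplete_def by auto

lemma complete_bipartite_digraph_Kbipartite: "K\<^bsub>d,d\<^esub> (with_proj (Kbipartite d))"
  unfolding complete_bipartite_digraph_pair_def Kbipartite_def
  by (intro conjI exI[of _ "Inl ` {..<d}"] exI[of _ "Inr ` {..<d}"])
     (auto simp: Plus_def card_image)

text \<open>
  \<open>0 powr x = 0\<close>, which is the intended value: a loopless \<open>H\<close> has no homomorphism from
  \<open>Kcomplete (d + 1)\<close> once \<open>d\<close> is large.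
\<close>

definition complete_bipartite_type :: "'a pair_pre_digraph \<Rightarrow> bool" where
  "complete_bipartite_type H \<longleftrightarrow>
     (\<exists>d0>0. \<forall>d\<ge>d0.
        real (hom_count (Kcomplete (d + 1)) H) powr (1 / real (d + 1))
          < real (hom_count (Kbipartite d) H) powr (1 / real (2 * d)))"

definition complete_type :: "'a pair_pre_digraph \<Rightarrow> bool" where
  "complete_type H \<longleftrightarrow>
     (\<exists>d0>0. \<forall>d\<ge>d0.
        real (hom_count (Kbipartite d) H) powr (1 / real (2 * d))
          < real (hom_count (Kcomplete (d + 1)) H) powr (1 / real (d + 1)))"


subsection \<open>Complete bipartite images\<close>

definition complete_bipartite_images :: "'a pair_pre_digraph \<Rightarrow> ('a set \<times> 'a set) set" where
  "complete_bipartite_images H =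
     {(A, B). A \<subseteq> pverts H \<and> B \<subseteq> pverts H \<and> A \<noteq> {} \<and> B \<noteq> {} \<and>
        (\<forall>a\<in>A. \<forall>b\<in>B. (a, b) \<in> parcs H)}"

definition eta_of :: "'a pair_pre_digraph \<Rightarrow> nat" where
  "eta_of H = Max {card A * card B | A B. (A, B) \<in> complete_bipartite_images H}"

definition m_of :: "'a pair_pre_digraph \<Rightarrow> nat" where
  "m_of H = card {(A, B) \<in> complete_bipartite_images H. card A * card B = eta_of H}"


subsection \<open>Complete images\<close>

definition complete_images :: "'a pair_pre_digraph \<Rightarrow> ('a set \<times> 'a set) set" where
  "complete_images H =
     {(A, B). A \<subseteq> pverts H \<and> B \<subseteq> pverts H \<and> A \<inter> B = {} \<and> A \<noteq> {} \<and>
        complete_looped (with_proj H \<restriction> A) \<and> K\<^bsub>card B\<^esub> (with_proj H \<restriction> B) \<and>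
        (\<forall>a\<in>A. \<forall>b\<in>B. (a, b) \<in> parcs H)}"

text \<open>
  The next three parameters are meaningful only if \<open>H\<close> has a loop (otherwise
  \<^const>\<open>complete_images\<close> is empty and \<^const>\<open>Max\<close> is unspecified).
\<close>

definition a_of :: "'a pair_pre_digraph \<Rightarrow> nat" where
  "a_of H = Max {card A | A B. (A, B) \<in> complete_images H}"

definition b_of :: "'a pair_pre_digraph \<Rightarrow> nat" where
  "b_of H = Max {card B | A B. (A, B) \<in> complete_images H \<and> card A = a_of H}"

definition n_of :: "'a pair_pre_digraph \<Rightarrow> nat" where
  "n_of H = card {(A, B) \<in> complete_images H. card A = a_of H \<and> card B = b_of H}"


subsection \<open>Secondary parameters\<close>

text \<open>
  Everything below is meaningful only if \<open>H\<close> has a loop, \<open>(a_of H)\<^sup>2 = eta_of H\<close> and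
  \<open>m_of H = n_of H = 1\<close>; under these assumptions the set described by the
  definite description exists. The \<open>insert 0\<close> in the maxima gives the value \<open>0\<close> when there is
  no image of the required kind.
\<close>

definition A0_of :: "'a pair_pre_digraph \<Rightarrow> 'a set" where
  "A0_of H = (THE A0. A0 \<subseteq> pverts H \<and> card A0 = a_of H \<and>
     {(A, B) \<in> complete_images H. card A = a_of H} = {(A0, {})} \<and>
     {(A, B) \<in> complete_bipartite_images H. card A * card B = eta_of H} = {(A0, A0)})"

definition complete_images' :: "'a pair_pre_digraph \<Rightarrow> ('a set \<times> 'a set) set" where
  "complete_images' H = {(A, B) \<in> complete_images H. \<not> A \<union> B \<subseteq> A0_of H}"

definition a'_of :: "'a pair_pre_digraph \<Rightarrow> nat" where
  "a'_of H = Max (insert 0 {card A | A B. (A, B) \<in> complete_images' H})"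

definition b'_of :: "'a pair_pre_digraph \<Rightarrow> nat" where
  "b'_of H = Max (insert 0 {card B | A B. (A, B) \<in> complete_images' H \<and> card A = a'_of H})"

definition n'_of :: "'a pair_pre_digraph \<Rightarrow> nat" where
  "n'_of H = card {(A, B) \<in> complete_images' H. card A = a'_of H \<and> card B = b'_of H}"

definition complete_bipartite_images' :: "'a pair_pre_digraph \<Rightarrow> ('a set \<times> 'a set) set" where
  "complete_bipartite_images' H =
     {(A, B) \<in> complete_bipartite_images H. \<not> A \<subseteq> A0_of H \<or> \<not> B \<subseteq> A0_of H}"

definition eta'_of :: "'a pair_pre_digraph \<Rightarrow> nat" where
  "eta'_of H = Max (insert 0 {card A * card B | A B. (A, B) \<in> complete_bipartite_images' H})"

definition m'_of :: "'a pair_pre_digraph \<Rightarrow> nat" where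
  "m'_of H = card {(A, B) \<in> complete_bipartite_images' H. card A * card B = eta'_of H}"

end

theory Submission
  imports Defs "HOL-Real_Asymp.Real_Asymp"
begin

text \<open>
  Sorting homomorphisms by their image shows that \<open>hom(K_{d,d}, H)\<close> is a sum over complete
  bipartite images of products of two surjection numbers, and that \<open>hom(K_{d+1}, H)\<close> is a sum over
  complete images. Hence they are \<open>m \<eta>^d\<close> and, if \<open>b = 0\<close>, \<open>n a^(d+1)\<close> up to exponentially
  small relative errors. After taking logarithms the bases decide if \<open>a^2 < \<eta>\<close>. If
  \<open>a^2 = \<eta>\<close> then \<open>b = 0\<close>, and \<open>ln n / (d + 1)\<close> is compared with \<open>ln m / (2 d)\<close>;
  for \<open>m = n^2 > 1\<close> the denominators favour the bipartite side. If \<open>m = n = 1\<close>, the maps into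
  \<open>A_0\<close> contribute exactly \<open>a^(d+1)\<close> and \<open>a^(2 d)\<close>, and the same comparison is made for the
  remaining maps, after division by \<open>(\<eta>' / a^2)^d\<close>; here \<open>\<eta>' > 0\<close> because \<open>H\<close> has no isolated
  vertex and is not a complete looped graph.
\<close>

subsection \<open>Rapid convergence\<close>

text \<open>Two ties shape the estimates: m = n^2 > 1 and 2 n' a' = a m'. There the two normalised
  logarithms have equal leading coefficients and differ only through the denominators d and d + 1,
  so a gap of relative order 1/d must survive every error term. Exponentially small errors are
  available by integrality: a size below the maximum is at most the maximum minus one.

  For m = n = 1 that argument alone is too coarse: its error, of order (\<eta> - 1)^d, is at least
  as large as \<eta>'^d, the order of the next term. All maps into A_0, onto or not, are therefore
  grouped before counting, and the asymptotics are applied anew to the images that leave A_0.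

  Origin of 2 n' a' \<le> a m': if a a' = \<eta>' and b' = 0, about n' a'^(d+1) maps from K_{d+1}
  remain; relative to a^(d+1) this is n' (a'/a) (\<eta>'/a^2)^d. The relative excess on the
  bipartite side is m' (\<eta>'/a^2)^d, halved by the root of order 2 d. If b' > 0, the free
  position of a loopless vertex supplies a factor d + 1, which outgrows any constant.\<close>

lemma poly_times_geometric_tendsto_0:
  fixes \<rho> :: real
  assumes "0 \<le> \<rho>" "\<rho> < 1"
  shows "(\<lambda>n. real n ^ k * \<rho> ^ n) \<longlonglongrightarrow> 0"
\<comment> \<open>The case \<open>\<rho> = 0\<close> does arise: the ratios used later are
  \<open>(\<eta> - 1) / \<eta>\<close> and \<open>(a - 1) / a\<close>, which vanish when the maximum
  is 1.\<close>
proof (cases "\<rho> = 0")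
  case True
  have "\<forall>\<^sub>F n in sequentially. real n ^ k * \<rho> ^ n = 0"
    using eventually_gt_at_top[of 0] by eventually_elim (simp add: True)
  then show ?thesis by (simp add: tendsto_eventually)
next
  case False
  with assms have "0 < \<rho>" "\<rho> < 1" by auto
  then show ?thesis by real_asymp
qed

text \<open>
  Comparing \<open>X d / (d + 1)\<close> with \<open>Y d / d\<close> when \<open>X\<close> and \<open>Y\<close> have the same limit
  needs errors of order \<open>o(1 / d)\<close>.
\<close>

definition rapidly_tends :: "(nat \<Rightarrow> real) \<Rightarrow> real \<Rightarrow> bool" where
  "rapidly_tends f c \<longleftrightarrow> (\<lambda>n. real n * (f n - c)) \<longlonglongrightarrow> 0"

lemma rapidly_tends_imp_tendsto:
  assumes "rapidly_tends f c"
  shows "f \<longlonglongrightarrow> c"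
proof -
  have "(\<lambda>n. real n * (f n - c) * (1 / real n)) \<longlonglongrightarrow> 0 * 0"
    using assms unfolding rapidly_tends_def by (intro tendsto_mult lim_1_over_n)
  moreover have "\<forall>\<^sub>F n in sequentially. real n * (f n - c) * (1 / real n) = f n - c"
    using eventually_gt_at_top[of 0] by eventually_elim simp
  ultimately have "(\<lambda>n. f n - c) \<longlonglongrightarrow> 0"
    by (simp add: filterlim_cong[OF refl refl])
  then show ?thesis by (simp add: LIM_zero_iff)
qed

lemma rapidly_tends_cong:
  assumes "\<forall>\<^sub>F n in sequentially. f n = g n"
  shows "rapidly_tends f c \<longleftrightarrow> rapidly_tends g c"
  unfolding rapidly_tends_def
  by (rule filterlim_cong[OF refl refl]) (use assms in \<open>eventually_elim, simp\<close>)

lemma rapidly_tends_Suc: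
  assumes "rapidly_tends f c"
  shows "rapidly_tends (\<lambda>n. f (Suc n)) c"
proof -
  have "(\<lambda>n. real (Suc n) * (f (Suc n) - c)) \<longlonglongrightarrow> 0"
    using assms unfolding rapidly_tends_def by (rule LIMSEQ_Suc)
  moreover have "(\<lambda>n. f (Suc n) - c) \<longlonglongrightarrow> 0"
    using LIMSEQ_Suc[OF rapidly_tends_imp_tendsto[OF assms]] by (simp add: LIM_zero_iff)
  ultimately have "(\<lambda>n. real (Suc n) * (f (Suc n) - c) - (f (Suc n) - c)) \<longlonglongrightarrow> 0 - 0"
    by (rule tendsto_diff)
  then show ?thesis unfolding rapidly_tends_def by (simp add: algebra_simps)
qed

lemma rapidly_tends_cmult:
  assumes "rapidly_tends f c"
  shows "rapidly_tends (\<lambda>n. k * f n) (k * c)"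
proof -
  have "(\<lambda>n. k * (real n * (f n - c))) \<longlonglongrightarrow> k * 0"
    using assms unfolding rapidly_tends_def by (intro tendsto_intros)
  then show ?thesis unfolding rapidly_tends_def by (simp add: algebra_simps)
qed

lemma rapidly_tendsI_Lipschitz:
  assumes "rapidly_tends f c"
    and "\<forall>\<^sub>F n in sequentially. \<bar>g n - c'\<bar> \<le> K * \<bar>f n - c\<bar>"
  shows "rapidly_tends g c'"
  unfolding rapidly_tends_def
proof (rule tendsto_0_le[OF assms(1)[unfolded rapidly_tends_def]])
  show "\<forall>\<^sub>F n in sequentially. norm (real n * (g n - c')) \<le> norm (real n * (f n - c)) * K"
    using assms(2)
  proof eventually_elim
    case (elim n)
    from mult_left_mono[OF elim, of "real n"] assms(1) show ?case by (simp add: abs_mult mult_ac)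
  qed
qed

lemma rapidly_tendsI_geometric:
  fixes \<rho> :: real
  assumes "0 \<le> \<rho>" "\<rho> < 1"
    and "\<forall>\<^sub>F n in sequentially. \<bar>f n - c\<bar> \<le> K * (real n ^ k * \<rho> ^ n)"
  shows "rapidly_tends f c"
  unfolding rapidly_tends_def
proof (rule tendsto_0_le[OF poly_times_geometric_tendsto_0[OF assms(1,2)]])
  show "\<forall>\<^sub>F n in sequentially. norm (real n * (f n - c)) \<le> norm (real n ^ Suc k * \<rho> ^ n) * K"
    using assms(3)
  proof eventually_elim
    case (elim n)
    from mult_left_mono[OF elim, of "real n"] assms(1) show ?case by (simp add: abs_mult mult_ac)
  qed
qed

text \<open>Near \<open>c > 0\<close> the logarithm is Lipschitz: once \<open>f n > c / 2\<close>,
  the constant \<open>2 / c\<close> works on both sides of \<open>c\<close>.\<close>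

lemma rapidly_tends_ln:
  assumes f: "rapidly_tends f c" and c: "c > 0"
  shows "rapidly_tends (\<lambda>n. ln (f n)) (ln c)"
proof (rule rapidly_tendsI_Lipschitz[OF f])
  have "\<forall>\<^sub>F n in sequentially. f n > c / 2"
    using rapidly_tends_imp_tendsto[OF f] c by (intro order_tendstoD) auto
  then show "\<forall>\<^sub>F n in sequentially. \<bar>ln (f n) - ln c\<bar> \<le> (2 / c) * \<bar>f n - c\<bar>"
  proof eventually_elim
    case (elim n)
    then have pos: "f n > 0" using c by linarith
    have "f n - c \<le> 2 * \<bar>f n - c\<bar>" by (smt (verit))
    then have "(f n - c) / c \<le> (2 * \<bar>f n - c\<bar>) / c" using c by (intro divide_right_mono) auto
    with ln_diff_le[OF pos c] have 1: "ln (f n) - ln c \<le> (2 / c) * \<bar>f n - c\<bar>" by simp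
    have "ln c - ln (f n) \<le> (c - f n) / f n" using ln_diff_le[OF c pos] .
    also have "\<dots> \<le> \<bar>f n - c\<bar> / f n" using pos by (intro divide_right_mono) auto
    also have "\<dots> \<le> \<bar>f n - c\<bar> / (c / 2)" using pos elim c by (intro divide_left_mono) auto
    finally have "ln c - ln (f n) \<le> (2 / c) * \<bar>f n - c\<bar>" by (simp add: mult_ac)
    with 1 show ?case by linarith
  qed
qed

text \<open>The quadratic error of \<open>ln (1 + x)\<close> against \<open>x\<close>, divided by
  \<open>r ^ n\<close>, is still of order \<open>r ^ n\<close>. This passes from counts to
  logarithms when the excess itself decays like \<open>r ^ n\<close>.\<close>

lemma rapidly_tends_ln_one_plus:
  fixes r :: real
  assumes g: "rapidly_tends g c" and r: "0 < r" "r < 1"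
  shows "rapidly_tends (\<lambda>n. ln (1 + g n * r ^ n) / r ^ n) c"
proof -
  have gc: "g \<longlonglongrightarrow> c" by (rule rapidly_tends_imp_tendsto[OF g])
  have rn: "(\<lambda>n. r ^ n) \<longlonglongrightarrow> 0" using r by (simp add: LIMSEQ_realpow_zero)
  have "(\<lambda>n. g n * r ^ n) \<longlonglongrightarrow> c * 0" by (intro tendsto_mult gc rn)
  then have "(\<lambda>n. \<bar>g n * r ^ n\<bar>) \<longlonglongrightarrow> 0" by (simp add: tendsto_rabs_zero)
  then have small: "\<forall>\<^sub>F n in sequentially. \<bar>g n * r ^ n\<bar> < 1 / 2" by (rule order_tendstoD) simp
  have "(\<lambda>n. real n * (ln (1 + g n * r ^ n) / r ^ n - g n)) \<longlonglongrightarrow> 0"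
  proof (rule tendsto_0_le[where K = 1])
    have "(\<lambda>n. 2 * (g n)\<^sup>2 * (real n ^ 1 * r ^ n)) \<longlonglongrightarrow> 2 * c\<^sup>2 * 0"
      using r by (intro tendsto_intros gc poly_times_geometric_tendsto_0) auto
    then show "(\<lambda>n. 2 * (g n)\<^sup>2 * (real n * r ^ n)) \<longlonglongrightarrow> 0" by simp
    show "\<forall>\<^sub>F n in sequentially. norm (real n * (ln (1 + g n * r ^ n) / r ^ n - g n))
        \<le> norm (2 * (g n)\<^sup>2 * (real n * r ^ n)) * 1"
      using small
    proof eventually_elim
      case (elim n)
      have rp: "r ^ n > 0" using r by simp
      have "\<bar>ln (1 + g n * r ^ n) - g n * r ^ n\<bar> \<le> 2 * (g n * r ^ n)\<^sup>2"
        using elim by (intro abs_ln_one_plus_x_minus_x_bound) auto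
      then have "\<bar>ln (1 + g n * r ^ n) - g n * r ^ n\<bar> / r ^ n \<le> 2 * (g n * r ^ n)\<^sup>2 / r ^ n"
        using rp by (intro divide_right_mono) auto
      also have "2 * (g n * r ^ n)\<^sup>2 / r ^ n = 2 * (g n)\<^sup>2 * r ^ n"
        using rp by (simp add: power2_eq_square field_simps)
      also have "\<bar>ln (1 + g n * r ^ n) - g n * r ^ n\<bar> / r ^ n
          = \<bar>(ln (1 + g n * r ^ n) - g n * r ^ n) / r ^ n\<bar>"
        using rp by (simp only: abs_divide abs_of_pos)
      also have "(ln (1 + g n * r ^ n) - g n * r ^ n) / r ^ n = ln (1 + g n * r ^ n) / r ^ n - g n"
        using r by (simp add: diff_divide_distrib)
      finally have "real n * \<bar>ln (1 + g n * r ^ n) / r ^ n - g n\<bar> \<le> real n * (2 * (g n)\<^sup>2 * r ^ n)"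
        by (intro mult_left_mono) auto
      then show ?case using rp by (simp add: abs_mult mult_ac)
    qed
  qed
  from tendsto_add[OF this g[unfolded rapidly_tends_def]] show ?thesis
    unfolding rapidly_tends_def by (simp add: algebra_simps)
qed

text \<open>With denominators cleared the claim is \<open>d * X d < (d + 1) * Y d\<close>. The extra
  copy of \<open>Y d\<close>, tending to \<open>\<beta> > 0\<close>, decides the tie
  \<open>\<alpha> = \<beta>\<close>; rapid convergence keeps \<open>d * (X d - \<alpha>)\<close> and
  \<open>d * (Y d - \<beta>)\<close> from outweighing it.\<close>

lemma eventually_less_of_rapidly_tends:
  assumes X: "rapidly_tends X \<alpha>" and Y: "rapidly_tends Y \<beta>"
    and "\<alpha> \<le> \<beta>" "\<beta> > 0"
  shows "\<forall>\<^sub>F d in sequentially. X d / real (d + 1) < Y d / real d"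
proof -
  have Yb: "Y \<longlonglongrightarrow> \<beta>" by (rule rapidly_tends_imp_tendsto[OF Y])
  have "(\<lambda>d. real d * (X d - \<alpha>) - real d * (Y d - \<beta>) - Y d) \<longlonglongrightarrow> 0 - 0 - \<beta>"
    using X Y Yb unfolding rapidly_tends_def by (intro tendsto_diff)
  then have "\<forall>\<^sub>F d in sequentially. real d * (X d - \<alpha>) - real d * (Y d - \<beta>) - Y d < 0"
    using assms(4) by (intro order_tendstoD) auto
  then show ?thesis using eventually_gt_at_top[of 0]
  proof eventually_elim
    case (elim d)
    have "real d * \<alpha> \<le> real d * \<beta>" using assms(3) by (intro mult_left_mono) auto
    moreover have "real d * X d - real d * \<alpha> - (real d * Y d - real d * \<beta>) - Y d < 0"
      using elim(1) by (simp only: right_diff_distrib)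
    ultimately have "real d * X d < real d * Y d + Y d" by linarith
    then have "real d * X d < (real d + 1) * Y d" by (simp add: algebra_simps)
    then show ?case using elim by (simp add: field_simps)
  qed
qed

text \<open>The gap \<open>\<alpha> - \<beta>\<close> dominates the shift from \<open>d\<close> to
  \<open>d + 1\<close>, which costs only \<open>Y d / d\<close>.\<close>

lemma eventually_greater_of_rapidly_tends:
  assumes X: "rapidly_tends X \<alpha>" and Y: "rapidly_tends Y \<beta>" and "\<beta> < \<alpha>"
  shows "\<forall>\<^sub>F d in sequentially. Y d / real d < X d / real (d + 1)"
proof -
  have Xa: "X \<longlonglongrightarrow> \<alpha>" and Yb: "Y \<longlonglongrightarrow> \<beta>" using X Y by (auto dest: rapidly_tends_imp_tendsto)
  have "(\<lambda>d. X d - Y d - Y d * (1 / real d)) \<longlonglongrightarrow> \<alpha> - \<beta> - \<beta> * 0"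
    by (intro tendsto_intros Xa Yb lim_1_over_n)
  then have "\<forall>\<^sub>F d in sequentially. X d - Y d - Y d * (1 / real d) > 0"
    using assms(3) by (intro order_tendstoD) auto
  then show ?thesis using eventually_gt_at_top[of 0]
    by eventually_elim (simp add: field_simps)
qed


subsection \<open>Counting homomorphisms by their image\<close>

definition surjections :: "'a set \<Rightarrow> 'b set \<Rightarrow> ('a \<Rightarrow> 'b) set" where
  "surjections D A = {f \<in> D \<rightarrow>\<^sub>E A. f ` D = A}"

lemma card_surjections_le:
  assumes "finite D" "finite A"
  shows "card (surjections D A) \<le> card A ^ card D"
proof -
  have "card (surjections D A) \<le> card (D \<rightarrow>\<^sub>E A)"
    unfolding surjections_def using assms by (intro card_mono finite_PiE) auto
  then show ?thesis using assms by (simp add: card_PiE)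
qed

text \<open>A map that is not onto misses some \<open>a\<close>; the union bound over the sets
  \<open>A - {a}\<close> gives the correction. Its smaller base is the source of the exponentially
  small error for a single image.\<close>

lemma card_surjections_ge:
  assumes "finite D" "finite A"
  shows "card A ^ card D \<le> card (surjections D A) + card A * (card A - 1) ^ card D"
proof -
  have sub: "D \<rightarrow>\<^sub>E A \<subseteq> surjections D A \<union> (\<Union>a\<in>A. D \<rightarrow>\<^sub>E (A - {a}))"
    by (fastforce simp: surjections_def PiE_iff extensional_def)
  have "card A ^ card D = card (D \<rightarrow>\<^sub>E A)" using assms by (simp add: card_PiE)
  also have "\<dots> \<le> card (surjections D A \<union> (\<Union>a\<in>A. D \<rightarrow>\<^sub>E (A - {a})))"
    using assms by (intro card_mono sub) (auto simp: surjections_def finite_PiE)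
  also have "\<dots> \<le> card (surjections D A) + card (\<Union>a\<in>A. D \<rightarrow>\<^sub>E (A - {a}))"
    by (rule card_Un_le)
  also have "card (\<Union>a\<in>A. D \<rightarrow>\<^sub>E (A - {a})) \<le> (\<Sum>a\<in>A. card (D \<rightarrow>\<^sub>E (A - {a})))"
    using assms by (intro card_UN_le)
  also have "\<dots> = card A * (card A - 1) ^ card D"
    using assms by (simp add: card_PiE)
  finally show ?thesis by simp
qed

lemma card_eq_sum_fibres:
  assumes "finite X" "finite T" "g ` X \<subseteq> T"
  shows "card X = (\<Sum>t\<in>T. card {x \<in> X. g x = t})"
  using sum.group[OF assms, of "\<lambda>_. 1 :: nat"] by simp

definition homs :: "'a pair_pre_digraph \<Rightarrow> 'b pair_pre_digraph \<Rightarrow> ('a \<Rightarrow> 'b) set" where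
  "homs G H = {f \<in> pverts G \<rightarrow>\<^sub>E pverts H. \<forall>u v. (u, v) \<in> parcs G \<longrightarrow> (f u, f v) \<in> parcs H}"

lemma hom_count_eq_card_homs: "hom_count G H = card (homs G H)"
  by (simp add: hom_count_def homs_def)

lemma finite_homs:
  assumes "finite (pverts G)" "finite (pverts H)"
  shows "finite (homs G H)"
  unfolding homs_def using assms by (simp add: finite_PiE)

section \<open>Homomorphisms from K_{d,d} and complete bipartite images\<close>

lemma complete_bipartite_imagesI:
  assumes "A \<subseteq> pverts H" "B \<subseteq> pverts H" "A \<noteq> {}" "B \<noteq> {}"
    and "\<And>a b. a \<in> A \<Longrightarrow> b \<in> B \<Longrightarrow> (a, b) \<in> parcs H"
  shows "(A, B) \<in> complete_bipartite_images H"
  using assms by (auto simp: complete_bipartite_images_def)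

lemma complete_bipartite_imagesD:
  assumes "(A, B) \<in> complete_bipartite_images H"
  shows "A \<subseteq> pverts H" "B \<subseteq> pverts H" "A \<noteq> {}" "B \<noteq> {}"
    and "\<And>a b. a \<in> A \<Longrightarrow> b \<in> B \<Longrightarrow> (a, b) \<in> parcs H"
  using assms by (auto simp: complete_bipartite_images_def)

lemma finite_complete_bipartite_images:
  assumes "finite (pverts H)"
  shows "finite (complete_bipartite_images H)"
  by (rule finite_subset[of _ "Pow (pverts H) \<times> Pow (pverts H)"])
     (use assms in \<open>auto simp: complete_bipartite_images_def\<close>)

definition Kbipartite_image :: "nat \<Rightarrow> (nat + nat \<Rightarrow> 'a) \<Rightarrow> 'a set \<times> 'a set" where
  "Kbipartite_image d f = ((f \<circ> Inl) ` {..<d}, (f \<circ> Inr) ` {..<d})"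

lemma homs_Kbipartite_iff:
  assumes "pair_pseudo_graph H"
  shows "f \<in> homs (Kbipartite d) H \<longleftrightarrow> f \<in> ({..<d} <+> {..<d}) \<rightarrow>\<^sub>E pverts H \<and>
    (\<forall>i<d. \<forall>j<d. (f (Inl i), f (Inr j)) \<in> parcs H)"
proof -
  interpret pair_pseudo_graph H by fact
  have "(u, v) \<in> parcs H \<Longrightarrow> (v, u) \<in> parcs H" for u v
    using arcs_ends_symmetric[OF pair_sym_arcs] by simp
  then show ?thesis by (auto simp: homs_def Kbipartite_def)
qed

lemma Kbipartite_image_in_complete_bipartite_images:
  assumes "pair_pseudo_graph H" "d > 0" "f \<in> homs (Kbipartite d) H"
  shows "Kbipartite_image d f \<in> complete_bipartite_images H"
  using assms
  by (auto simp: homs_Kbipartite_iff Kbipartite_image_def PiE_iff intro!: complete_bipartite_imagesI)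

text \<open>All arcs between \<open>A\<close> and \<open>B\<close> are present, so the two classes
  are mapped independently: a homomorphism with image pair \<open>(A, B)\<close> is a surjection
  onto \<open>A\<close> together with one onto \<open>B\<close>.\<close>

lemma card_Kbipartite_fibre:
  assumes "pair_pseudo_graph H" "(A, B) \<in> complete_bipartite_images H"
  shows "card {f \<in> homs (Kbipartite d) H. Kbipartite_image d f = (A, B)}
    = card (surjections {..<d} A) * card (surjections {..<d} B)"
proof -
  note AB = complete_bipartite_imagesD[OF assms(2)]
  let ?h = "\<lambda>f. (restrict (f \<circ> Inl) {..<d}, restrict (f \<circ> Inr) {..<d})"
  let ?k = "\<lambda>(g, h). restrict (case_sum g h) ({..<d} <+> {..<d})"
  have "bij_betw ?h {f \<in> homs (Kbipartite d) H. Kbipartite_image d f = (A, B)}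
      (surjections {..<d} A \<times> surjections {..<d} B)"
  proof (rule bij_betw_byWitness[where f' = ?k])
    show "\<forall>f\<in>{f \<in> homs (Kbipartite d) H. Kbipartite_image d f = (A, B)}. ?k (?h f) = f"
      by (auto simp: homs_Kbipartite_iff[OF assms(1)] PiE_iff extensional_def fun_eq_iff
            restrict_def split: sum.splits)
    show "\<forall>p\<in>surjections {..<d} A \<times> surjections {..<d} B. ?h (?k p) = p"
      by (auto simp: surjections_def PiE_iff extensional_def fun_eq_iff restrict_def)
    show "?h ` {f \<in> homs (Kbipartite d) H. Kbipartite_image d f = (A, B)}
        \<subseteq> surjections {..<d} A \<times> surjections {..<d} B"
      by (auto simp: surjections_def Kbipartite_image_def split: if_splits)
    show "?k ` (surjections {..<d} A \<times> surjections {..<d} B)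
        \<subseteq> {f \<in> homs (Kbipartite d) H. Kbipartite_image d f = (A, B)}"
    proof (rule image_subsetI)
      fix p assume "p \<in> surjections {..<d} A \<times> surjections {..<d} B"
      then obtain g h where p: "p = (g, h)"
        and gh: "g \<in> surjections {..<d} A" "h \<in> surjections {..<d} B" by blast
      then have "g i \<in> A" "h i \<in> B" if "i < d" for i
        using that by (auto simp: surjections_def)
      then have "?k (g, h) \<in> homs (Kbipartite d) H"
        using AB by (auto simp: homs_Kbipartite_iff[OF assms(1)])
      moreover have "Kbipartite_image d (?k (g, h)) = (A, B)"
        using gh by (auto simp: Kbipartite_image_def surjections_def image_comp)
      ultimately show "?k p \<in> {f \<in> homs (Kbipartite d) H. Kbipartite_image d f = (A, B)}"
        unfolding p by simp
    qed
  qed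
  then show ?thesis by (simp add: bij_betw_same_card card_cartesian_product)
qed

lemma card_homs_Kbipartite:
  assumes H: "pair_pseudo_graph H" and S: "S \<subseteq> complete_bipartite_images H"
  shows "card {f \<in> homs (Kbipartite d) H. Kbipartite_image d f \<in> S}
    = (\<Sum>(A, B)\<in>S. card (surjections {..<d} A) * card (surjections {..<d} B))"
proof -
  interpret pair_pseudo_graph H by fact
  let ?X = "{f \<in> homs (Kbipartite d) H. Kbipartite_image d f \<in> S}"
  have fin: "finite ?X"
    using finite_homs[of "Kbipartite d" H] pair_finite_verts by (simp add: Kbipartite_def)
  have "finite S" using finite_complete_bipartite_images[OF pair_finite_verts] S
    by (rule finite_subset[rotated])
  then have "card ?X = (\<Sum>t\<in>S. card {f \<in> ?X. Kbipartite_image d f = t})"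
    using fin by (intro card_eq_sum_fibres) auto
  also have "\<dots> = (\<Sum>(A, B)\<in>S. card (surjections {..<d} A) * card (surjections {..<d} B))"
  proof (rule sum.cong, safe)
    fix A B assume AB: "(A, B) \<in> S"
    then have "{f \<in> ?X. Kbipartite_image d f = (A, B)}
        = {f \<in> homs (Kbipartite d) H. Kbipartite_image d f = (A, B)}" by auto
    then show "card {f \<in> ?X. Kbipartite_image d f = (A, B)}
        = card (surjections {..<d} A) * card (surjections {..<d} B)"
      using card_Kbipartite_fibre[OF H] AB S by auto
  qed
  finally show ?thesis .
qed

section \<open>Homomorphisms from complete graphs and complete images\<close>

text \<open>Induced subgraphs and the clique predicate are unfolded to arcs once and for all.
  Finiteness of \<open>B\<close> and the absence of loops on \<open>B\<close> both come from the
  clique predicate.\<close>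

lemma complete_images_iff:
  "(A, B) \<in> complete_images H \<longleftrightarrow>
     A \<subseteq> pverts H \<and> B \<subseteq> pverts H \<and> A \<inter> B = {} \<and> A \<noteq> {} \<and> finite B \<and>
     (\<forall>u\<in>A. \<forall>v\<in>A. (u, v) \<in> parcs H) \<and> (\<forall>u\<in>B. \<forall>v\<in>B. (u, v) \<in> parcs H \<longleftrightarrow> u \<noteq> v) \<and>
     (\<forall>a\<in>A. \<forall>b\<in>B. (a, b) \<in> parcs H)"
proof -
  let ?R = "\<lambda>B. \<lparr> pverts = B, parcs = {e \<in> parcs H. fst e \<in> B \<and> snd e \<in> B} \<rparr>"
  have ind: "with_proj H \<restriction> B = with_proj (?R B)" for B
    by (simp add: induce_subgraph_def with_proj_def)
  have "complete_looped (with_proj H \<restriction> A) \<longleftrightarrow>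
      (\<forall>u\<in>A. \<forall>v\<in>A. u \<noteq> v \<longrightarrow> (u, v) \<in> parcs H) \<and> (\<forall>v\<in>A. (v, v) \<in> parcs H)"
    unfolding ind complete_looped_def by simp
  also have "\<dots> \<longleftrightarrow> (\<forall>u\<in>A. \<forall>v\<in>A. (u, v) \<in> parcs H)" by metis
  finally have 1: "complete_looped (with_proj H \<restriction> A) \<longleftrightarrow> (\<forall>u\<in>A. \<forall>v\<in>A. (u, v) \<in> parcs H)" .
  have "{e \<in> parcs H. fst e \<in> B \<and> snd e \<in> B} = {(u, v). (u, v) \<in> B \<times> B \<and> u \<noteq> v} \<longleftrightarrow>
      (\<forall>u\<in>B. \<forall>v\<in>B. (u, v) \<in> parcs H \<longleftrightarrow> u \<noteq> v)"
    unfolding set_eq_iff by (simp add: split_paired_All) blast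
  then have 2: "K\<^bsub>card B\<^esub> (with_proj H \<restriction> B) \<longleftrightarrow>
      finite B \<and> (\<forall>u\<in>B. \<forall>v\<in>B. (u, v) \<in> parcs H \<longleftrightarrow> u \<noteq> v)"
    unfolding ind complete_digraph_pair_def by simp
  show ?thesis unfolding complete_images_def mem_Collect_eq prod.case 1 2 by (simp only: conj_ac)
qed

lemma finite_complete_images:
  assumes "finite (pverts H)"
  shows "finite (complete_images H)"
  by (rule finite_subset[of _ "Pow (pverts H) \<times> Pow (pverts H)"])
     (use assms in \<open>auto simp: complete_images_iff\<close>)

definition Kcomplete_image :: "'a pair_pre_digraph \<Rightarrow> nat \<Rightarrow> (nat \<Rightarrow> 'a) \<Rightarrow> 'a set \<times> 'a set" where
  "Kcomplete_image H n f =
     ({v \<in> f ` {..<n}. (v, v) \<in> parcs H}, {v \<in> f ` {..<n}. (v, v) \<notin> parcs H})"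

lemma homs_Kcomplete_iff:
  "f \<in> homs (Kcomplete n) H \<longleftrightarrow> f \<in> {..<n} \<rightarrow>\<^sub>E pverts H \<and>
    (\<forall>i<n. \<forall>j<n. i \<noteq> j \<longrightarrow> (f i, f j) \<in> parcs H)"
  by (auto simp: homs_def Kcomplete_def)

text \<open>With more clique vertices than vertices of \<open>H\<close>, two of them share a value;
  being adjacent, they force a loop there, so the looped part is nonempty.\<close>

lemma Kcomplete_image_in_complete_images:
  assumes "finite (pverts H)" "f \<in> homs (Kcomplete n) H" "n > card (pverts H)"
  shows "Kcomplete_image H n f \<in> complete_images H"
proof -
  have f: "f i \<in> pverts H" "j < n \<Longrightarrow> i \<noteq> j \<Longrightarrow> (f i, f j) \<in> parcs H" if "i < n" for i j
    using assms(2) that by (auto simp: homs_Kcomplete_iff)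
  have sub: "f ` {..<n} \<subseteq> pverts H" using f by auto
  have "\<not> inj_on f {..<n}"
    using card_inj_on_le[OF _ sub assms(1)] assms(3) by auto
  then obtain i j where "i < n" "j < n" "i \<noteq> j" "f i = f j" by (auto simp: inj_on_def)
  then have "(f i, f i) \<in> parcs H" using f(2)[of i j] by simp
  then have ne: "{v \<in> f ` {..<n}. (v, v) \<in> parcs H} \<noteq> {}" using \<open>i < n\<close> by blast
  have adj: "(u, v) \<in> parcs H" if "u \<in> f ` {..<n}" "v \<in> f ` {..<n}" "u \<noteq> v" for u v
    using that f by auto
  let ?A = "{v \<in> f ` {..<n}. (v, v) \<in> parcs H}" and ?B = "{v \<in> f ` {..<n}. (v, v) \<notin> parcs H}"
  have c1: "\<forall>u\<in>?A. \<forall>v\<in>?A. (u, v) \<in> parcs H"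
  proof (intro ballI)
    fix u v assume "u \<in> ?A" "v \<in> ?A"
    then show "(u, v) \<in> parcs H" using adj by (cases "u = v") simp_all
  qed
  have c2: "\<forall>u\<in>?B. \<forall>v\<in>?B. (u, v) \<in> parcs H \<longleftrightarrow> u \<noteq> v"
    using adj by (metis (no_types, lifting) mem_Collect_eq)
  have c3: "\<forall>a\<in>?A. \<forall>b\<in>?B. (a, b) \<in> parcs H"
    using adj by (metis (no_types, lifting) mem_Collect_eq)
  have c4: "?A \<subseteq> pverts H" "?B \<subseteq> pverts H" "?A \<inter> ?B = {}" "finite ?B"
    using sub by auto
  show ?thesis
    unfolding Kcomplete_image_def complete_images_iff by (intro conjI c1 c2 c3 c4 ne)
qed

lemma card_homs_Kcomplete:
  assumes "finite (pverts H)" and T: "T \<subseteq> complete_images H"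
  shows "card {f \<in> homs (Kcomplete n) H. Kcomplete_image H n f \<in> T}
    = (\<Sum>t\<in>T. card {f \<in> homs (Kcomplete n) H. Kcomplete_image H n f = t})"
proof -
  let ?X = "{f \<in> homs (Kcomplete n) H. Kcomplete_image H n f \<in> T}"
  have fin: "finite ?X"
    using finite_homs[of "Kcomplete n" H] assms(1) by (simp add: Kcomplete_def)
  have "finite T" using finite_complete_images[OF assms(1)] T
    by (rule finite_subset[rotated])
  then have "card ?X = (\<Sum>t\<in>T. card {f \<in> ?X. Kcomplete_image H n f = t})"
    using fin by (intro card_eq_sum_fibres) auto
  also have "\<dots> = (\<Sum>t\<in>T. card {f \<in> homs (Kcomplete n) H. Kcomplete_image H n f = t})"
    by (intro sum.cong arg_cong[where f = card]) auto
  finally show ?thesis .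
qed

lemma Kcomplete_fibre_looped:
  assumes "(A, {}) \<in> complete_images H"
  shows "{f \<in> homs (Kcomplete n) H. Kcomplete_image H n f = (A, {})} = surjections {..<n} A"
proof -
  have A: "A \<subseteq> pverts H" "\<And>u v. u \<in> A \<Longrightarrow> v \<in> A \<Longrightarrow> (u, v) \<in> parcs H"
    using assms by (auto simp: complete_images_iff)
  have "f \<in> homs (Kcomplete n) H \<and> Kcomplete_image H n f = (A, {}) \<longleftrightarrow>
      f \<in> surjections {..<n} A" for f
  proof
    assume "f \<in> homs (Kcomplete n) H \<and> Kcomplete_image H n f = (A, {})"
    then show "f \<in> surjections {..<n} A"
      by (auto simp: homs_Kcomplete_iff Kcomplete_image_def surjections_def PiE_iff)
  next
    assume "f \<in> surjections {..<n} A"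
    then have f: "f \<in> {..<n} \<rightarrow>\<^sub>E A" "f ` {..<n} = A" by (auto simp: surjections_def)
    have "Kcomplete_image H n f = (A, {})" using A(2) by (auto simp: Kcomplete_image_def f(2))
    moreover have "f \<in> homs (Kcomplete n) H" using f(1) A by (auto simp: homs_Kcomplete_iff PiE_iff)
    ultimately show "f \<in> homs (Kcomplete n) H \<and> Kcomplete_image H n f = (A, {})" by simp
  qed
  then show ?thesis by blast
qed

text \<open>Two preimages of a loopless vertex would be adjacent and create a loop, so each vertex
  of \<open>B\<close> is hit exactly once. The map is determined by the positions of these hits and
  by its values in \<open>A\<close> elsewhere.\<close>

lemma card_Kcomplete_fibre_le:
  assumes "finite (pverts H)" "(A, B) \<in> complete_images H"
  shows "card {f \<in> homs (Kcomplete n) H. Kcomplete_image H n f = (A, B)} \<le> n ^ card B * card A ^ n"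
proof -
  let ?X = "{f \<in> homs (Kcomplete n) H. Kcomplete_image H n f = (A, B)}"
  have AB: "A \<inter> B = {}" "A \<noteq> {}" "finite A" "finite B"
    using assms by (auto simp: complete_images_iff intro: finite_subset)
  obtain a0 where a0: "a0 \<in> A" using AB by blast
  \<comment> \<open>\<open>a0\<close> is filler at the positions that \<open>f\<close> sends to
    \<open>B\<close>, so that the second component maps into \<open>A\<close>; the first component
    records those positions.\<close>
  let ?p = "\<lambda>f. (\<lambda>b\<in>B. SOME i. i < n \<and> f i = b, \<lambda>i\<in>{..<n}. if f i \<in> A then f i else a0)"
  have img: "f i \<in> A \<or> f i \<in> B" "B \<subseteq> f ` {..<n}" if "f \<in> ?X" "i < n" for f i
    using that by (auto simp: Kcomplete_image_def)
  have pick: "(SOME i. i < n \<and> f i = b) < n" "f (SOME i. i < n \<and> f i = b) = b"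
    if "f \<in> ?X" "b \<in> B" for f b
  proof -
    have "\<exists>i. i < n \<and> f i = b" using that by (auto simp: Kcomplete_image_def)
    from someI_ex[OF this] show "(SOME i. i < n \<and> f i = b) < n" "f (SOME i. i < n \<and> f i = b) = b"
      by auto
  qed
  have uniq: "(SOME i. i < n \<and> f i = f j) = j" if "f \<in> ?X" "j < n" "f j \<in> B" for f j
  proof (rule ccontr)
    let ?i = "SOME i. i < n \<and> f i = f j"
    assume "?i \<noteq> j"
    moreover have "?i < n" "f ?i = f j" using pick that by blast+
    ultimately have "(f j, f j) \<in> parcs H" using that homs_Kcomplete_iff[of f n H] by fastforce
    then show False using that by (auto simp: Kcomplete_image_def)
  qed
  have "inj_on ?p ?X"
  proof (rule inj_onI)
    fix f g assume f: "f \<in> ?X" and g: "g \<in> ?X" and eq: "?p f = ?p g"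
    \<comment> \<open>Stated for arbitrary \<open>f\<close> and \<open>g\<close> because it is
      applied in both directions: either of the two maps may be the one that sends \<open>i\<close>
      into \<open>B\<close>.\<close>
    have half: "f i = g i" if f: "f \<in> ?X" and g: "g \<in> ?X" and eq: "?p f = ?p g"
      and "i < n" "f i \<in> B" for f g i
    proof -
      have "(SOME k. k < n \<and> g k = f i) = (SOME k. k < n \<and> f k = f i)"
        using fun_cong[OF conjunct1[OF eq[unfolded prod.inject]], of "f i"] that by simp
      also have "\<dots> = i" using uniq that by blast
      finally show ?thesis using pick(2)[OF g \<open>f i \<in> B\<close>] by simp
    qed
    show "f = g"
    proof
      fix i
      show "f i = g i"
      proof (cases "i < n")
        case True
        consider "f i \<in> B" | "g i \<in> B" | "f i \<in> A" "g i \<in> A"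
          using img(1)[OF f True] img(1)[OF g True] by blast
        then show ?thesis
        proof cases
          case 1 then show ?thesis using half[OF f g eq True] by blast
        next
          case 2 then show ?thesis using half[OF g f eq[symmetric] True] by simp
        next
          case 3 then show ?thesis
            using fun_cong[OF conjunct2[OF eq[unfolded prod.inject]], of i] True by simp
        qed
      next
        case False
        then show ?thesis using f g by (auto simp: homs_Kcomplete_iff PiE_iff extensional_def)
      qed
    qed
  qed
  moreover have "?p ` ?X \<subseteq> (B \<rightarrow>\<^sub>E {..<n}) \<times> ({..<n} \<rightarrow>\<^sub>E A)"
    using a0 pick by (auto split: if_splits)
  ultimately have "card ?X \<le> card ((B \<rightarrow>\<^sub>E {..<n}) \<times> ({..<n} \<rightarrow>\<^sub>E A))"
    using AB by (intro card_inj_on_le) (auto intro!: finite_PiE)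
  then show ?thesis using AB by (simp add: card_cartesian_product card_PiE)
qed

section \<open>Asymptotics of the two counts\<close>

text \<open>Every error has base at most \<open>\<eta> - 1\<close>: an image with
  \<open>a * b = \<eta>\<close> loses maps of orders \<open>(a * (b - 1)) ^ d\<close> and
  \<open>((a - 1) * b) ^ d\<close>, and a smaller image has integer size at most
  \<open>\<eta> - 1\<close>. The set \<open>S\<close> is a parameter because the estimate serves all
  images and, later, only those that leave \<open>A0\<close>.\<close>

lemma real_card_homs_Kbipartite_asymp:
  fixes \<eta> :: nat
  assumes H: "pair_pseudo_graph H" and S: "S \<subseteq> complete_bipartite_images H"
    and le: "\<forall>(A, B)\<in>S. card A * card B \<le> \<eta>" and "\<eta> > 0"
  shows "\<exists>K. \<forall>d. \<bar>real (card {f \<in> homs (Kbipartite d) H. Kbipartite_image d f \<in> S})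
      - real (card {(A, B) \<in> S. card A * card B = \<eta>}) * real \<eta> ^ d\<bar> \<le> K * (real \<eta> - 1) ^ d"
proof (intro exI allI)
  fix d :: nat
  interpret pair_pseudo_graph H by fact
  have finS: "finite S"
    using finite_complete_bipartite_images[OF pair_finite_verts] S by (rule finite_subset[rotated])
  let ?s = "\<lambda>A. real (card (surjections {..<d} A))"
  let ?t = "\<lambda>A B. if card A * card B = \<eta> then real \<eta> ^ d else 0"
  have eta1: "real \<eta> - 1 \<ge> 0" using assms(4) by simp
  have each: "\<bar>?s A * ?s B - ?t A B\<bar> \<le> real (card A + card B) * (real \<eta> - 1) ^ d"
    if AB: "(A, B) \<in> S" for A B
  proof -
    note D = complete_bipartite_imagesD[OF subsetD[OF S AB]]
    have fin: "finite A" "finite B" using D pair_finite_verts by (auto intro: finite_subset)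
    then have pos: "card A > 0" "card B > 0" using D by (auto simp: card_gt_0_iff)
    define a b where "a = real (card A)" and "b = real (card B)"
    have ab: "a \<ge> 1" "b \<ge> 1" "a * b \<le> real \<eta>"
      using pos bspec[OF le AB] by (auto simp: a_def b_def simp flip: of_nat_mult)
    have up: "?s A \<le> a ^ d" "?s B \<le> b ^ d"
      using card_surjections_le[of "{..<d}" A] card_surjections_le[of "{..<d}" B] fin
      by (simp_all add: a_def b_def flip: of_nat_power)
    have lowgen: "real (card C) ^ d \<le> ?s C + real (card C) * (real (card C) - 1) ^ d"
      if "finite C" "card C > 0" for C :: "'a set"
    proof -
      have "real (card C ^ d) \<le> real (card (surjections {..<d} C) + card C * (card C - 1) ^ d)"
        unfolding of_nat_le_iff using card_surjections_ge[of "{..<d}" C] that by simp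
      then show ?thesis using that by (simp add: of_nat_diff)
    qed
    have low: "a ^ d - a * (a - 1) ^ d \<le> ?s A" "b ^ d - b * (b - 1) ^ d \<le> ?s B"
      using lowgen[OF fin(1) pos(1)] lowgen[OF fin(2) pos(2)] by (simp_all add: a_def b_def)
    have prod_up: "?s A * ?s B \<le> (a * b) ^ d"
      using mult_mono[OF up] ab by (simp add: power_mult_distrib)
    show ?thesis
    proof (cases "card A * card B = \<eta>")
      case True
      then have e: "a * b = real \<eta>" by (auto simp: a_def b_def)
      have "(a * b) ^ d - ?s A * ?s B = a ^ d * (b ^ d - ?s B) + (a ^ d - ?s A) * ?s B"
        by (simp add: algebra_simps power_mult_distrib)
      also have "\<dots> \<le> a ^ d * (b * (b - 1) ^ d) + (a * (a - 1) ^ d) * b ^ d"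
        using low up ab by (intro add_mono mult_mono) auto
      also have "\<dots> = b * (a * (b - 1)) ^ d + a * ((a - 1) * b) ^ d"
        by (simp add: power_mult_distrib mult_ac)
      also have "\<dots> \<le> b * (real \<eta> - 1) ^ d + a * (real \<eta> - 1) ^ d"
        using ab unfolding e[symmetric]
        by (intro add_mono mult_left_mono power_mono) (auto simp: algebra_simps)
      finally have "real \<eta> ^ d - ?s A * ?s B \<le> (a + b) * (real \<eta> - 1) ^ d"
        unfolding e by (simp add: distrib_right)
      moreover have "?s A * ?s B \<le> real \<eta> ^ d" using prod_up unfolding e .
      ultimately show ?thesis using True by (simp add: a_def b_def)
    next
      case False
      then have "card A * card B \<le> \<eta> - 1" using bspec[OF le AB] by simp
      then have "real (card A * card B) \<le> real (\<eta> - 1)" by (simp only: of_nat_le_iff)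
      then have "a * b \<le> real \<eta> - 1" using assms(4) by (simp add: a_def b_def of_nat_diff)
      then have "(a * b) ^ d \<le> (real \<eta> - 1) ^ d" using ab by (intro power_mono) auto
      also have "\<dots> = 1 * (real \<eta> - 1) ^ d" by simp
      also have "\<dots> \<le> (a + b) * (real \<eta> - 1) ^ d" using ab eta1 by (intro mult_right_mono) auto
      finally show ?thesis using False prod_up by (simp add: a_def b_def)
    qed
  qed
  have "real (card {f \<in> homs (Kbipartite d) H. Kbipartite_image d f \<in> S}) = (\<Sum>(A, B)\<in>S. ?s A * ?s B)"
    unfolding card_homs_Kbipartite[OF H S] by (simp add: case_prod_beta)
  moreover have "real (card {(A, B) \<in> S. card A * card B = \<eta>}) * real \<eta> ^ d = (\<Sum>(A, B)\<in>S. ?t A B)"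
  proof -
    have "{(A, B) \<in> S. card A * card B = \<eta>} = {t \<in> S. card (fst t) * card (snd t) = \<eta>}" by auto
    then show ?thesis using finS by (simp add: case_prod_beta sum.If_cases Int_def)
  qed
  ultimately have "\<bar>real (card {f \<in> homs (Kbipartite d) H. Kbipartite_image d f \<in> S})
      - real (card {(A, B) \<in> S. card A * card B = \<eta>}) * real \<eta> ^ d\<bar>
      = \<bar>\<Sum>(A, B)\<in>S. ?s A * ?s B - ?t A B\<bar>"
    by (simp only: sum_subtractf case_prod_beta')
  also have "\<dots> \<le> (\<Sum>(A, B)\<in>S. \<bar>?s A * ?s B - ?t A B\<bar>)"
    unfolding case_prod_beta by (rule sum_abs)
  also have "\<dots> \<le> (\<Sum>(A, B)\<in>S. real (card A + card B) * (real \<eta> - 1) ^ d)"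
    unfolding case_prod_beta by (rule sum_mono) (use each in auto)
  also have "\<dots> = (\<Sum>(A, B)\<in>S. real (card A + card B)) * (real \<eta> - 1) ^ d"
    by (simp add: sum_distrib_right case_prod_beta)
  finally show "\<bar>real (card {f \<in> homs (Kbipartite d) H. Kbipartite_image d f \<in> S})
      - real (card {(A, B) \<in> S. card A * card B = \<eta>}) * real \<eta> ^ d\<bar>
      \<le> (\<Sum>(A, B)\<in>S. real (card A + card B)) * (real \<eta> - 1) ^ d" .
qed

lemma card_Kcomplete_fibre_le_uniform:
  assumes "finite (pverts H)" "(A, B) \<in> complete_images H" "card A \<le> a" "n > 0"
  shows "card {f \<in> homs (Kcomplete n) H. Kcomplete_image H n f = (A, B)} \<le> n ^ card (pverts H) * a ^ n"
proof -
  have "card B \<le> card (pverts H)"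
    using assms by (intro card_mono) (auto simp: complete_images_iff)
  then have "n ^ card B * card A ^ n \<le> n ^ card (pverts H) * a ^ n"
    using assms by (intro mult_mono power_increasing power_mono) auto
  with card_Kcomplete_fibre_le[OF assms(1,2), of n] show ?thesis by linarith
qed

lemma card_homs_Kcomplete_le:
  assumes fin: "finite (pverts H)" and T: "T \<subseteq> complete_images H"
    and le: "\<forall>(A, B)\<in>T. card A \<le> a" and "n > 0"
  shows "card {f \<in> homs (Kcomplete n) H. Kcomplete_image H n f \<in> T}
    \<le> card T * (n ^ card (pverts H) * a ^ n)"
proof -
  have "(\<Sum>t\<in>T. card {f \<in> homs (Kcomplete n) H. Kcomplete_image H n f = t})
      \<le> (\<Sum>t\<in>T. n ^ card (pverts H) * a ^ n)"
  proof (rule sum_mono)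
    fix t assume t: "t \<in> T"
    obtain A B where AB: "t = (A, B)" by fastforce
    show "card {f \<in> homs (Kcomplete n) H. Kcomplete_image H n f = t} \<le> n ^ card (pverts H) * a ^ n"
      unfolding AB using t T le assms(4)
      by (intro card_Kcomplete_fibre_le_uniform[OF fin]) (auto simp: AB)
  qed
  then show ?thesis unfolding card_homs_Kcomplete[OF fin T] by simp
qed

text \<open>The assumption \<open>top\<close> keeps the polynomial factor caused by loopless
  vertices off the leading term: images with \<open>card A = a\<close> are counted by surjections
  alone, and the factor \<open>n ^ card (pverts H)\<close> only meets the base
  \<open>a - 1\<close>.\<close>

lemma real_card_homs_Kcomplete_asymp:
  fixes a :: nat
  assumes fin: "finite (pverts H)" and T: "T \<subseteq> complete_images H"
    and le: "\<forall>(A, B)\<in>T. card A \<le> a" and "a > 0"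
    and top: "\<forall>(A, B)\<in>T. card A = a \<longrightarrow> B = {}"
  shows "\<exists>K. \<forall>n>0. \<bar>real (card {f \<in> homs (Kcomplete n) H. Kcomplete_image H n f \<in> T})
      - real (card {(A, B) \<in> T. card A = a}) * real a ^ n\<bar>
      \<le> K * (real n ^ card (pverts H) * (real a - 1) ^ n)"
proof (intro exI allI impI)
  fix n :: nat assume n: "n > 0"
  have finT: "finite T"
    using finite_complete_images[OF fin] T by (rule finite_subset[rotated])
  let ?q = "card (pverts H)"
  let ?s = "\<lambda>t. real (card {f \<in> homs (Kcomplete n) H. Kcomplete_image H n f = t})"
  let ?t = "\<lambda>(A, B). if card A = a then real a ^ n else 0"
  have a1: "real a - 1 \<ge> 0" and n1: "real n ^ ?q \<ge> 1"
    using assms(4) n by (simp_all add: one_le_power)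
  have each: "\<bar>?s t - ?t t\<bar> \<le> real a * (real n ^ ?q * (real a - 1) ^ n)" if t: "t \<in> T" for t
  proof -
    obtain A B where AB: "t = (A, B)" by fastforce
    have tC: "(A, B) \<in> complete_images H" using t T AB by auto
    then have finA: "finite A" using fin by (auto simp: complete_images_iff intro: finite_subset)
    show ?thesis
    proof (cases "card A = a")
      case True
      then have B: "B = {}" using top t AB by auto
      have s: "?s t = real (card (surjections {..<n} A))"
        unfolding AB using Kcomplete_fibre_looped[of A H n] tC B by simp
      have up: "?s t \<le> real a ^ n"
        unfolding s using card_surjections_le[of "{..<n}" A] finA True by (simp flip: of_nat_power)
      have "real (a ^ n) \<le> real (card (surjections {..<n} A) + a * (a - 1) ^ n)"
        unfolding of_nat_le_iff using card_surjections_ge[of "{..<n}" A] finA True by simp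
      then have "real a ^ n - ?s t \<le> real a * (real a - 1) ^ n"
        unfolding s using assms(4) by (simp add: of_nat_diff)
      also have "\<dots> = real a * (1 * (real a - 1) ^ n)" by simp
      also have "\<dots> \<le> real a * (real n ^ ?q * (real a - 1) ^ n)"
        using a1 n1 by (intro mult_left_mono mult_right_mono) auto
      finally show ?thesis using up True AB by simp
    next
      case False
      then have "card A \<le> a - 1" using le t AB by fastforce
      then have "?s t \<le> real (n ^ ?q * (a - 1) ^ n)"
        unfolding AB of_nat_le_iff by (intro card_Kcomplete_fibre_le_uniform fin tC n)
      also have "\<dots> = 1 * (real n ^ ?q * (real a - 1) ^ n)" using assms(4) by (simp add: of_nat_diff)
      also have "\<dots> \<le> real a * (real n ^ ?q * (real a - 1) ^ n)"
        using a1 assms(4) by (intro mult_right_mono) auto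
      finally show ?thesis using False AB by simp
    qed
  qed
  have "real (card {f \<in> homs (Kcomplete n) H. Kcomplete_image H n f \<in> T}) = (\<Sum>t\<in>T. ?s t)"
    unfolding card_homs_Kcomplete[OF fin T] by simp
  moreover have "real (card {(A, B) \<in> T. card A = a}) * real a ^ n = (\<Sum>t\<in>T. ?t t)"
  proof -
    have "{(A, B) \<in> T. card A = a} = {t \<in> T. card (fst t) = a}" by auto
    then show ?thesis using finT by (simp add: case_prod_beta sum.If_cases Int_def)
  qed
  ultimately have "\<bar>real (card {f \<in> homs (Kcomplete n) H. Kcomplete_image H n f \<in> T})
      - real (card {(A, B) \<in> T. card A = a}) * real a ^ n\<bar> = \<bar>\<Sum>t\<in>T. ?s t - ?t t\<bar>"
    by (simp only: sum_subtractf)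
  also have "\<dots> \<le> (\<Sum>t\<in>T. \<bar>?s t - ?t t\<bar>)" by (rule sum_abs)
  also have "\<dots> \<le> (\<Sum>t\<in>T. real a * (real n ^ ?q * (real a - 1) ^ n))"
    by (rule sum_mono) (rule each)
  also have "\<dots> = (real (card T) * real a) * (real n ^ ?q * (real a - 1) ^ n)" by simp
  finally show "\<bar>real (card {f \<in> homs (Kcomplete n) H. Kcomplete_image H n f \<in> T})
      - real (card {(A, B) \<in> T. card A = a}) * real a ^ n\<bar>
      \<le> (real (card T) * real a) * (real n ^ ?q * (real a - 1) ^ n)" .
qed

lemma rapidly_tends_card_homs_Kbipartite:
  fixes \<eta> :: nat
  assumes H: "pair_pseudo_graph H" and S: "S \<subseteq> complete_bipartite_images H"
    and le: "\<forall>(A, B)\<in>S. card A * card B \<le> \<eta>" and "\<eta> > 0"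
  shows "rapidly_tends
    (\<lambda>d. real (card {f \<in> homs (Kbipartite d) H. Kbipartite_image d f \<in> S}) / real \<eta> ^ d)
    (real (card {(A, B) \<in> S. card A * card B = \<eta>}))"
proof -
  obtain K where K: "\<bar>real (card {f \<in> homs (Kbipartite d) H. Kbipartite_image d f \<in> S})
      - real (card {(A, B) \<in> S. card A * card B = \<eta>}) * real \<eta> ^ d\<bar> \<le> K * (real \<eta> - 1) ^ d" for d
    using real_card_homs_Kbipartite_asymp[OF assms] by blast
  show ?thesis
  proof (rule rapidly_tendsI_geometric[where k = 0 and \<rho> = "(real \<eta> - 1) / real \<eta>"])
    show "\<forall>\<^sub>F d in sequentially.
      \<bar>real (card {f \<in> homs (Kbipartite d) H. Kbipartite_image d f \<in> S}) / real \<eta> ^ d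
        - real (card {(A, B) \<in> S. card A * card B = \<eta>})\<bar>
      \<le> K * (real d ^ 0 * ((real \<eta> - 1) / real \<eta>) ^ d)"
    proof (rule always_eventually, rule allI)
      fix d :: nat
      let ?P = "real (card {f \<in> homs (Kbipartite d) H. Kbipartite_image d f \<in> S})"
      let ?m = "real (card {(A, B) \<in> S. card A * card B = \<eta>})"
      have pos: "real \<eta> ^ d > 0" using assms(4) by simp
      have "\<bar>?P / real \<eta> ^ d - ?m\<bar> = \<bar>(?P - ?m * real \<eta> ^ d) / real \<eta> ^ d\<bar>"
        using assms(4) by (simp add: diff_divide_distrib)
      also have "\<dots> = \<bar>?P - ?m * real \<eta> ^ d\<bar> / real \<eta> ^ d"
        using pos by (simp only: abs_divide abs_of_pos)
      also have "\<dots> \<le> K * (real \<eta> - 1) ^ d / real \<eta> ^ d"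
        using pos by (intro divide_right_mono K) auto
      finally show "\<bar>?P / real \<eta> ^ d - ?m\<bar> \<le> K * (real d ^ 0 * ((real \<eta> - 1) / real \<eta>) ^ d)"
        by (simp add: power_divide)
    qed
  qed (use assms(4) in auto)
qed

lemma rapidly_tends_card_homs_Kcomplete:
  fixes a :: nat
  assumes "finite (pverts H)" and "T \<subseteq> complete_images H"
    and "\<forall>(A, B)\<in>T. card A \<le> a" and "a > 0"
    and "\<forall>(A, B)\<in>T. card A = a \<longrightarrow> B = {}"
  shows "rapidly_tends
    (\<lambda>n. real (card {f \<in> homs (Kcomplete n) H. Kcomplete_image H n f \<in> T}) / real a ^ n)
    (real (card {(A, B) \<in> T. card A = a}))"
proof -
  obtain K where K: "\<bar>real (card {f \<in> homs (Kcomplete n) H. Kcomplete_image H n f \<in> T})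
      - real (card {(A, B) \<in> T. card A = a}) * real a ^ n\<bar>
      \<le> K * (real n ^ card (pverts H) * (real a - 1) ^ n)" if "n > 0" for n
    using real_card_homs_Kcomplete_asymp[OF assms] by blast
  show ?thesis
  proof (rule rapidly_tendsI_geometric[where k = "card (pverts H)" and \<rho> = "(real a - 1) / real a"])
    show "\<forall>\<^sub>F n in sequentially.
      \<bar>real (card {f \<in> homs (Kcomplete n) H. Kcomplete_image H n f \<in> T}) / real a ^ n
        - real (card {(A, B) \<in> T. card A = a})\<bar>
      \<le> K * (real n ^ card (pverts H) * ((real a - 1) / real a) ^ n)"
      using eventually_gt_at_top[of 0]
    proof eventually_elim
      case (elim n)
      let ?C = "real (card {f \<in> homs (Kcomplete n) H. Kcomplete_image H n f \<in> T})"
      let ?N = "real (card {(A, B) \<in> T. card A = a})"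
      have pos: "real a ^ n > 0" using assms(4) by simp
      have "\<bar>?C / real a ^ n - ?N\<bar> = \<bar>(?C - ?N * real a ^ n) / real a ^ n\<bar>"
        using assms(4) by (simp add: diff_divide_distrib)
      also have "\<dots> = \<bar>?C - ?N * real a ^ n\<bar> / real a ^ n"
        using pos by (simp only: abs_divide abs_of_pos)
      also have "\<dots> \<le> K * (real n ^ card (pverts H) * (real a - 1) ^ n) / real a ^ n"
        using pos by (intro divide_right_mono K elim) auto
      finally show ?case by (simp add: power_divide)
    qed
  qed (use assms(4) in auto)
qed


subsection \<open>Targets with a loop\<close>

lemma Max_pairs_ge:
  assumes "finite {(A, B). P A B}" "P A B"
  shows "g A B \<le> Max {g A B | A B. P A B}"
proof (rule Max_ge)
  have "{g A B | A B. P A B} = (\<lambda>(A, B). g A B) ` {(A, B). P A B}" by auto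
  then show "finite {g A B | A B. P A B}" using assms(1) by simp
qed (use assms(2) in blast)

lemma Max_pairs_attained:
  assumes "finite {(A, B). P A B}" "P A0 B0"
  shows "\<exists>A B. P A B \<and> g A B = Max {g A B | A B. P A B}"
proof -
  have "{g A B | A B. P A B} = (\<lambda>(A, B). g A B) ` {(A, B). P A B}" by auto
  then have "finite {g A B | A B. P A B}" using assms(1) by simp
  moreover have "{g A B | A B. P A B} \<noteq> {}" using assms(2) by blast
  ultimately have "Max {g A B | A B. P A B} \<in> {g A B | A B. P A B}" by (rule Max_in)
  then show ?thesis by force
qed

lemma Max_insert_0_pairs_ge:
  fixes g :: "'a \<Rightarrow> 'b \<Rightarrow> nat"
  assumes "finite {(A, B). P A B}" "P A B"
  shows "g A B \<le> Max (insert 0 {g A B | A B. P A B})"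
proof (rule Max_ge)
  have "{g A B | A B. P A B} = (\<lambda>(A, B). g A B) ` {(A, B). P A B}" by auto
  then show "finite (insert 0 {g A B | A B. P A B})" using assms(1) by simp
qed (use assms(2) in blast)

lemma Max_insert_0_pairs_attained:
  fixes g :: "'a \<Rightarrow> 'b \<Rightarrow> nat"
  assumes "finite {(A, B). P A B}" "Max (insert 0 {g A B | A B. P A B}) > 0"
  shows "\<exists>A B. P A B \<and> g A B = Max (insert 0 {g A B | A B. P A B})"
proof -
  have "{g A B | A B. P A B} = (\<lambda>(A, B). g A B) ` {(A, B). P A B}" by auto
  then have "finite (insert 0 {g A B | A B. P A B})" using assms(1) by simp
  then have "Max (insert 0 {g A B | A B. P A B}) \<in> insert 0 {g A B | A B. P A B}"
    by (rule Max_in) simp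
  then show ?thesis using assms(2) by force
qed

lemma complete_bipartite_type_iff_eventually:
  "complete_bipartite_type H \<longleftrightarrow> (\<forall>\<^sub>F d in sequentially.
     real (hom_count (Kcomplete (d + 1)) H) powr (1 / real (d + 1))
       < real (hom_count (Kbipartite d) H) powr (1 / real (2 * d)))"
  unfolding complete_bipartite_type_def eventually_sequentially
  by (metis less_Suc_eq_0_disj Suc_leD zero_less_Suc)

lemma complete_type_iff_eventually:
  "complete_type H \<longleftrightarrow> (\<forall>\<^sub>F d in sequentially.
     real (hom_count (Kbipartite d) H) powr (1 / real (2 * d))
       < real (hom_count (Kcomplete (d + 1)) H) powr (1 / real (d + 1)))"
  unfolding complete_type_def eventually_sequentially
  by (metis less_Suc_eq_0_disj Suc_leD zero_less_Suc)

lemma not_both_types: "\<not> (complete_bipartite_type H \<and> complete_type H)"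
proof
  assume "complete_bipartite_type H \<and> complete_type H"
  then have "\<forall>\<^sub>F d :: nat in sequentially. False"
    unfolding complete_bipartite_type_iff_eventually complete_type_iff_eventually
      eventually_conj_iff[symmetric]
    by (elim eventually_mono) linarith
  then show False by simp
qed

lemma powr_inverse_eq_exp:
  fixes a x :: real
  assumes "a > 0" "x > 0" "k > 0"
  shows "x powr (1 / real k) = a * exp (ln (x / a ^ k) / real k)"
proof -
  have "ln (x / a ^ k) / real k = ln x / real k - ln a"
    using assms by (simp add: ln_div ln_realpow field_simps)
  then show ?thesis using assms by (simp add: powr_def exp_diff)
qed

lemma powr_inverse_double_eq_exp:
  fixes a x :: real
  assumes "a > 0" "x > 0" "k > 0"
  shows "x powr (1 / real (2 * k)) = a * exp (ln (x / (a\<^sup>2) ^ k) / 2 / real k)"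
  using powr_inverse_eq_exp[OF assms(1,2), of "2 * k"] assms(3) by (simp add: power_mult)

locale looped_pseudo_graph =
  fixes H :: "'a pair_pre_digraph"
  assumes pseudo: "pair_pseudo_graph H" and loop: "has_loop H"
begin

lemma finite_verts: "finite (pverts H)"
  using pseudo by (simp add: pair_pseudo_graph_def pair_fin_digraph_def pair_fin_digraph_axioms_def)

lemma finite_images:
  "finite {(A, B). (A, B) \<in> complete_images H}"
  "finite {(A, B). (A, B) \<in> complete_images H \<and> Q A B}"
  "finite {(A, B). (A, B) \<in> complete_bipartite_images H}"
  "finite {(A, B). (A, B) \<in> complete_bipartite_images H \<and> R A B}"
  using finite_complete_images[OF finite_verts] finite_complete_bipartite_images[OF finite_verts]
  by (auto elim: finite_subset[rotated])

lemma complete_images_finite: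
  assumes "(A, B) \<in> complete_images H"
  shows "finite A" "finite B"
  using assms finite_verts by (auto simp: complete_images_iff intro: finite_subset)

lemma singleton_complete_image: "\<exists>v. v \<in> pverts H \<and> (v, v) \<in> parcs H \<and> ({v}, {}) \<in> complete_images H"
  using loop by (auto simp: has_loop_def complete_images_iff)

lemma card_le_a_of: "(A, B) \<in> complete_images H \<Longrightarrow> card A \<le> a_of H"
  unfolding a_of_def by (rule Max_pairs_ge[OF finite_images(1)])

lemma a_of_attained: "\<exists>A B. (A, B) \<in> complete_images H \<and> card A = a_of H"
proof -
  obtain v where "({v}, {}) \<in> complete_images H" using singleton_complete_image by blast
  then show ?thesis unfolding a_of_def by (rule Max_pairs_attained[OF finite_images(1)])
qed

lemma a_of_pos: "a_of H > 0"
proof -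
  obtain v where "({v}, {}) \<in> complete_images H" using singleton_complete_image by blast
  from card_le_a_of[OF this] show ?thesis by simp
qed

lemma card_le_b_of:
  assumes "(A, B) \<in> complete_images H" "card A = a_of H"
  shows "card B \<le> b_of H"
  unfolding b_of_def using assms by (intro Max_pairs_ge[OF finite_images(2)] conjI)

lemma b_of_attained: "\<exists>A B. (A, B) \<in> complete_images H \<and> card A = a_of H \<and> card B = b_of H"
proof -
  obtain A B where "(A, B) \<in> complete_images H \<and> card A = a_of H" using a_of_attained by blast
  then have "\<exists>A B. ((A, B) \<in> complete_images H \<and> card A = a_of H) \<and> card B = b_of H"
    unfolding b_of_def by (rule Max_pairs_attained[OF finite_images(2)])
  then show ?thesis by blast
qed

lemma n_of_pos: "n_of H > 0"
  unfolding n_of_def using b_of_attained finite_images(2) by (subst card_gt_0_iff) (simp, blast)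

lemma card_mult_le_eta_of: "(A, B) \<in> complete_bipartite_images H \<Longrightarrow> card A * card B \<le> eta_of H"
  unfolding eta_of_def by (rule Max_pairs_ge[OF finite_images(3)])

text \<open>Vertices of \<open>A\<close> are joined to all of \<open>A\<close>, themselves included,
  and to all of \<open>B\<close>. The resulting inequality a (a + b) \<le> \<eta> gives a^2 \<le>
  \<eta> and, in case of equality, b = 0.\<close>

lemma complete_image_imp_complete_bipartite_image:
  assumes "(A, B) \<in> complete_images H"
  shows "(A, A \<union> B) \<in> complete_bipartite_images H"
  using assms by (auto simp: complete_images_iff complete_bipartite_images_def)

lemma a_of_times_card_Un:
  assumes "(A, B) \<in> complete_images H"
  shows "card A * (card A + card B) \<le> eta_of H"
  using card_mult_le_eta_of[OF complete_image_imp_complete_bipartite_image[OF assms]] assms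
    complete_images_finite[OF assms]
  by (simp add: card_Un_disjoint complete_images_iff)

lemma eta_of_attained: "\<exists>A B. (A, B) \<in> complete_bipartite_images H \<and> card A * card B = eta_of H"
proof -
  obtain v where "({v}, {}) \<in> complete_images H" using singleton_complete_image by blast
  from complete_image_imp_complete_bipartite_image[OF this]
  show ?thesis unfolding eta_of_def by (rule Max_pairs_attained[OF finite_images(3)])
qed

lemma m_of_pos: "m_of H > 0"
  unfolding m_of_def using eta_of_attained finite_images(4) by (subst card_gt_0_iff) simp

lemma a_of_square_le_eta_of: "(a_of H)\<^sup>2 \<le> eta_of H"
proof -
  obtain A B where AB: "(A, B) \<in> complete_images H" "card A = a_of H" using a_of_attained by blast
  have "a_of H * a_of H \<le> a_of H * (a_of H + card B)" by simp
  then show ?thesis using a_of_times_card_Un[OF AB(1)] unfolding AB(2) power2_eq_square by linarith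
qed

lemma eta_of_pos: "eta_of H > 0"
  using a_of_square_le_eta_of a_of_pos by (metis le_zero_eq neq0_conv power_not_zero)

lemma b_of_eq_0:
  assumes "(a_of H)\<^sup>2 = eta_of H"
  shows "b_of H = 0"
proof -
  obtain A B where AB: "(A, B) \<in> complete_images H" "card A = a_of H" "card B = b_of H"
    using b_of_attained by blast
  from a_of_times_card_Un[OF AB(1)] have "a_of H * (a_of H + b_of H) \<le> a_of H * a_of H"
    using AB(2,3) assms by (simp add: power2_eq_square)
  then show ?thesis using a_of_pos by simp
qed

lemma top_image_loopless_part_empty:
  assumes "(a_of H)\<^sup>2 = eta_of H" "(A, B) \<in> complete_images H" "card A = a_of H"
  shows "B = {}"
  using card_le_b_of[OF assms(2,3)] b_of_eq_0[OF assms(1)] complete_images_finite(2)[OF assms(2)] by simp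

lemma hom_count_pos:
  "hom_count (Kcomplete n) H > 0" "hom_count (Kbipartite d) H > 0"
proof -
  obtain v where v: "v \<in> pverts H" "(v, v) \<in> parcs H" using singleton_complete_image by blast
  have "(\<lambda>i\<in>pverts (Kcomplete n). v) \<in> homs (Kcomplete n) H"
    unfolding homs_Kcomplete_iff using v by (auto simp: Kcomplete_def)
  then show "hom_count (Kcomplete n) H > 0"
    unfolding hom_count_eq_card_homs using finite_homs[of "Kcomplete n" H] finite_verts
    by (auto simp: card_gt_0_iff Kcomplete_def)
  have "(\<lambda>i\<in>pverts (Kbipartite d). v) \<in> homs (Kbipartite d) H"
    unfolding homs_Kbipartite_iff[OF pseudo] using v by (auto simp: Kbipartite_def)
  then show "hom_count (Kbipartite d) H > 0"
    unfolding hom_count_eq_card_homs using finite_homs[of "Kbipartite d" H] finite_verts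
    by (auto simp: card_gt_0_iff Kbipartite_def)
qed

text \<open>
  Both definitions subtract the common leading term \<open>ln (a_of H)\<close> from the logarithms of the two
  roots: these are \<open>ln (a_of H) + complete_excess (d + 1) / (d + 1)\<close> and
  \<open>ln (a_of H) + bipartite_excess d / d\<close>.
\<close>

definition complete_excess :: "nat \<Rightarrow> real" where
  "complete_excess n = ln (real (hom_count (Kcomplete n) H) / real (a_of H) ^ n)"

definition bipartite_excess :: "nat \<Rightarrow> real" where
  "bipartite_excess d = ln (real (hom_count (Kbipartite d) H) / ((real (a_of H))\<^sup>2) ^ d) / 2"

lemma complete_bipartite_typeI:
  assumes "\<forall>\<^sub>F d in sequentially. complete_excess (Suc d) / real (d + 1) < bipartite_excess d / real d"
  shows "complete_bipartite_type H"
  unfolding complete_bipartite_type_iff_eventually using assms eventually_gt_at_top[of 0]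
proof eventually_elim
  case (elim d)
  then show ?case
    using powr_inverse_eq_exp[of "real (a_of H)" "real (hom_count (Kcomplete (d + 1)) H)" "d + 1"]
      powr_inverse_double_eq_exp[of "real (a_of H)" "real (hom_count (Kbipartite d) H)" d]
      a_of_pos hom_count_pos
    by (simp add: complete_excess_def bipartite_excess_def)
qed

lemma complete_typeI:
  assumes "\<forall>\<^sub>F d in sequentially. bipartite_excess d / real d < complete_excess (Suc d) / real (d + 1)"
  shows "complete_type H"
  unfolding complete_type_iff_eventually using assms eventually_gt_at_top[of 0]
proof eventually_elim
  case (elim d)
  then show ?case
    using powr_inverse_eq_exp[of "real (a_of H)" "real (hom_count (Kcomplete (d + 1)) H)" "d + 1"]
      powr_inverse_double_eq_exp[of "real (a_of H)" "real (hom_count (Kbipartite d) H)" d]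
      a_of_pos hom_count_pos
    by (simp add: complete_excess_def bipartite_excess_def)
qed

lemma hom_count_Kcomplete_eq:
  assumes "n > card (pverts H)"
  shows "hom_count (Kcomplete n) H
    = card {f \<in> homs (Kcomplete n) H. Kcomplete_image H n f \<in> complete_images H}"
  unfolding hom_count_eq_card_homs
  using Kcomplete_image_in_complete_images[OF finite_verts _ assms]
  by (intro arg_cong[where f = card]) auto

lemma hom_count_Kbipartite_eq:
  assumes "d > 0"
  shows "hom_count (Kbipartite d) H
    = card {f \<in> homs (Kbipartite d) H. Kbipartite_image d f \<in> complete_bipartite_images H}"
  unfolding hom_count_eq_card_homs
  using Kbipartite_image_in_complete_bipartite_images[OF pseudo assms]
  by (intro arg_cong[where f = card]) auto

lemma rapidly_tends_hom_count_Kbipartite: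
  "rapidly_tends (\<lambda>d. real (hom_count (Kbipartite d) H) / real (eta_of H) ^ d) (real (m_of H))"
proof -
  have "rapidly_tends (\<lambda>d. real (card {f \<in> homs (Kbipartite d) H.
      Kbipartite_image d f \<in> complete_bipartite_images H}) / real (eta_of H) ^ d) (real (m_of H))"
    unfolding m_of_def using card_mult_le_eta_of eta_of_pos
    by (intro rapidly_tends_card_homs_Kbipartite[OF pseudo]) auto
  moreover have "\<forall>\<^sub>F d in sequentially. real (hom_count (Kbipartite d) H) / real (eta_of H) ^ d
      = real (card {f \<in> homs (Kbipartite d) H.
        Kbipartite_image d f \<in> complete_bipartite_images H}) / real (eta_of H) ^ d"
    using eventually_gt_at_top[of 0] by eventually_elim (simp add: hom_count_Kbipartite_eq)
  ultimately show ?thesis by (rule rapidly_tends_cong[THEN iffD2, rotated])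
qed

lemma rapidly_tends_complete_excess:
  assumes "(a_of H)\<^sup>2 = eta_of H"
  shows "rapidly_tends (\<lambda>d. complete_excess (Suc d)) (ln (real (n_of H)))"
proof -
  \<comment> \<open>\<open>n_of H\<close> also prescribes \<open>card B = b_of H\<close>, which is 0
    here; images of primary size \<open>a_of H\<close> satisfy this automatically.\<close>
  have n: "n_of H = card {(A, B) \<in> complete_images H. card A = a_of H}"
    unfolding n_of_def b_of_eq_0[OF assms]
    by (intro arg_cong[where f = card]) (auto dest: top_image_loopless_part_empty[OF assms])
  have "rapidly_tends (\<lambda>n. real (card {f \<in> homs (Kcomplete n) H.
      Kcomplete_image H n f \<in> complete_images H}) / real (a_of H) ^ n) (real (n_of H))"
    unfolding n using card_le_a_of a_of_pos top_image_loopless_part_empty[OF assms]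
    by (intro rapidly_tends_card_homs_Kcomplete[OF finite_verts]) auto
  moreover have "\<forall>\<^sub>F n in sequentially. real (hom_count (Kcomplete n) H) / real (a_of H) ^ n
      = real (card {f \<in> homs (Kcomplete n) H.
        Kcomplete_image H n f \<in> complete_images H}) / real (a_of H) ^ n"
    using eventually_gt_at_top[of "card (pverts H)"]
    by eventually_elim (simp add: hom_count_Kcomplete_eq)
  ultimately have "rapidly_tends (\<lambda>n. real (hom_count (Kcomplete n) H) / real (a_of H) ^ n) (real (n_of H))"
    by (rule rapidly_tends_cong[THEN iffD2, rotated])
  then have "rapidly_tends complete_excess (ln (real (n_of H)))"
    unfolding complete_excess_def[abs_def] using n_of_pos by (intro rapidly_tends_ln) auto
  then show ?thesis by (rule rapidly_tends_Suc)
qed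

lemma rapidly_tends_bipartite_excess:
  assumes "(a_of H)\<^sup>2 = eta_of H"
  shows "rapidly_tends bipartite_excess (ln (real (m_of H)) / 2)"
proof -
  have "rapidly_tends (\<lambda>d. ln (real (hom_count (Kbipartite d) H) / real (eta_of H) ^ d)) (ln (real (m_of H)))"
    using m_of_pos by (intro rapidly_tends_ln rapidly_tends_hom_count_Kbipartite) auto
  from rapidly_tends_cmult[OF this, of "1 / 2"] show ?thesis
    by (simp add: bipartite_excess_def[abs_def] flip: assms)
qed

section \<open>Cases decided by the leading terms\<close>

text \<open>\<open>b_of H\<close> may be positive, so the complete side is only bounded by a
  polynomial in \<open>d\<close> times \<open>a ^ (d + 1)\<close>; this adds O(ln d / d) to the
  logarithm of the root. The bipartite side gains the fixed amount \<open>\<delta>\<close>.\<close>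

lemma complete_bipartite_type_of_square_less:
  assumes "(a_of H)\<^sup>2 < eta_of H"
  shows "complete_bipartite_type H"
proof (rule complete_bipartite_typeI)
  let ?q = "card (pverts H)" and ?a = "real (a_of H)" and ?\<eta> = "real (eta_of H)"
  define K where "K = real (card (complete_images H))"
  define \<delta> where "\<delta> = ln (?\<eta> / ?a\<^sup>2) / 2"
  define W where "W d = ln (real (hom_count (Kbipartite d) H) / ?\<eta> ^ d)" for d
  have a: "?a > 0" using a_of_pos by simp
  have "?a\<^sup>2 < ?\<eta>" using assms by (simp flip: of_nat_power)
  then have \<delta>: "\<delta> > 0" using a by (simp add: \<delta>_def)
  have W: "W \<longlonglongrightarrow> ln (real (m_of H))"
    unfolding W_def using m_of_pos
    by (intro rapidly_tends_imp_tendsto rapidly_tends_ln rapidly_tends_hom_count_Kbipartite) auto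
  have "complete_images H \<noteq> {}" using singleton_complete_image by blast
  then have K: "K > 0"
    using finite_complete_images[OF finite_verts] by (simp add: K_def card_gt_0_iff)
  \<comment> \<open>This sequence is a lower bound for the difference of the two normalised
    excesses.\<close>
  have "(\<lambda>d. \<delta> + W d / 2 * (1 / real d) - (ln K + real ?q * ln (real (Suc d))) / real (d + 1))
      \<longlonglongrightarrow> \<delta> + ln (real (m_of H)) / 2 * 0 - 0"
  proof (intro tendsto_intros W lim_1_over_n)
    show "(\<lambda>d. (ln K + real ?q * ln (real (Suc d))) / real (d + 1)) \<longlonglongrightarrow> 0" by real_asymp
  qed simp
  then have "\<forall>\<^sub>F d in sequentially.
      \<delta> + W d / 2 * (1 / real d) - (ln K + real ?q * ln (real (Suc d))) / real (d + 1) > 0"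
    using \<delta> by (intro order_tendstoD) auto
  then show "\<forall>\<^sub>F d in sequentially. complete_excess (Suc d) / real (d + 1) < bipartite_excess d / real d"
    using eventually_gt_at_top[of ?q] eventually_gt_at_top[of 0]
  proof eventually_elim
    case (elim d)
    have "hom_count (Kcomplete (Suc d)) H \<le> card (complete_images H) * (Suc d ^ ?q * a_of H ^ Suc d)"
    proof -
      have "Suc d > ?q" using elim by simp
      then show ?thesis
        unfolding hom_count_Kcomplete_eq[OF \<open>Suc d > ?q\<close>] using card_le_a_of
        by (intro card_homs_Kcomplete_le[OF finite_verts]) auto
    qed
    then have "real (hom_count (Kcomplete (Suc d)) H) \<le> K * (real (Suc d) ^ ?q * ?a ^ Suc d)"
      unfolding K_def by (simp only: of_nat_le_iff flip: of_nat_mult of_nat_power)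
    then have "real (hom_count (Kcomplete (Suc d)) H) / ?a ^ Suc d \<le> K * real (Suc d) ^ ?q"
      using a by (simp add: field_simps)
    then have "complete_excess (Suc d) \<le> ln (K * real (Suc d) ^ ?q)"
      unfolding complete_excess_def using hom_count_pos(1)[of "Suc d"] a K
      by (subst ln_le_cancel_iff) (auto intro!: mult_pos_pos divide_pos_pos zero_less_power)
    also have "\<dots> = ln K + real ?q * ln (real (Suc d))" using K by (simp add: ln_mult ln_realpow)
    finally have "complete_excess (Suc d) / real (d + 1)
        \<le> (ln K + real ?q * ln (real (Suc d))) / real (d + 1)" by (intro divide_right_mono) auto
    also have "\<dots> < \<delta> + W d / 2 * (1 / real d)" using elim(1) by linarith
    also have "\<dots> = bipartite_excess d / real d"
    proof -
      have "real (hom_count (Kbipartite d) H) / (?a\<^sup>2) ^ d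
          = real (hom_count (Kbipartite d) H) / ?\<eta> ^ d * (?\<eta> / ?a\<^sup>2) ^ d"
        using eta_of_pos by (simp add: power_divide)
      moreover have "real (hom_count (Kbipartite d) H) / ?\<eta> ^ d > 0" "?\<eta> / ?a\<^sup>2 > 0"
        using hom_count_pos(2)[of d] a eta_of_pos by simp_all
      ultimately have "ln (real (hom_count (Kbipartite d) H) / (?a\<^sup>2) ^ d) = W d + real d * (2 * \<delta>)"
        unfolding W_def \<delta>_def by (simp only: ln_mult_pos ln_realpow zero_less_power)
      then show ?thesis using elim by (simp add: bipartite_excess_def field_simps)
    qed
    finally show ?case .
  qed
qed

text \<open>n^2 \<le> m says that the limit ln n is at most ln m / 2; \<open>m_of H > 1\<close>
  makes the latter positive, which settles the tie n^2 = m.\<close>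

lemma complete_bipartite_type_of_m_ge:
  assumes "(a_of H)\<^sup>2 = eta_of H" "m_of H > 1" "(n_of H)\<^sup>2 \<le> m_of H"
  shows "complete_bipartite_type H"
proof (rule complete_bipartite_typeI, rule eventually_less_of_rapidly_tends)
  show "rapidly_tends (\<lambda>d. complete_excess (Suc d)) (ln (real (n_of H)))"
    by (rule rapidly_tends_complete_excess[OF assms(1)])
  show "rapidly_tends bipartite_excess (ln (real (m_of H)) / 2)"
    by (rule rapidly_tends_bipartite_excess[OF assms(1)])
  have "ln (real ((n_of H)\<^sup>2)) \<le> ln (real (m_of H))"
    using n_of_pos m_of_pos assms(3) by (subst ln_le_cancel_iff) (simp_all del: of_nat_power)
  then show "ln (real (n_of H)) \<le> ln (real (m_of H)) / 2" using n_of_pos by (simp add: ln_realpow)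
  show "ln (real (m_of H)) / 2 > 0" using assms(2) by simp
qed

lemma complete_type_of_m_less:
  assumes "(a_of H)\<^sup>2 = eta_of H" "m_of H < (n_of H)\<^sup>2"
  shows "complete_type H"
proof (rule complete_typeI, rule eventually_greater_of_rapidly_tends)
  show "rapidly_tends (\<lambda>d. complete_excess (Suc d)) (ln (real (n_of H)))"
    by (rule rapidly_tends_complete_excess[OF assms(1)])
  show "rapidly_tends bipartite_excess (ln (real (m_of H)) / 2)"
    by (rule rapidly_tends_bipartite_excess[OF assms(1)])
  have "ln (real (m_of H)) < ln (real ((n_of H)\<^sup>2))"
    using n_of_pos m_of_pos assms(2) by (subst ln_less_cancel_iff) (simp_all del: of_nat_power)
  then show "ln (real (m_of H)) / 2 < ln (real (n_of H))" using n_of_pos by (simp add: ln_realpow)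
qed

end


subsection \<open>Unique extremal images\<close>

locale uniquely_dominated_graph = looped_pseudo_graph +
  assumes square: "(a_of H)\<^sup>2 = eta_of H" and m_1: "m_of H = 1" and n_1: "n_of H = 1"
    and no_isolated: "\<not> (\<exists>v. isolated_vertex H v)"
    and not_complete_looped: "\<not> complete_looped (with_proj H)"
begin

abbreviation "A0 \<equiv> A0_of H"

text \<open>The unique image of primary size \<open>a_of H\<close> has empty loopless part, say
  \<open>(A, {})\<close>. It yields \<open>(A, A)\<close>, a complete bipartite image of size a^2 =
  \<eta>, and by \<open>m_1\<close> the only one of that size.\<close>

lemma A0_of_properties:
  "A0 \<subseteq> pverts H \<and> card A0 = a_of H \<and>
     {(A, B) \<in> complete_images H. card A = a_of H} = {(A0, {})} \<and>
     {(A, B) \<in> complete_bipartite_images H. card A * card B = eta_of H} = {(A0, A0)}"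
  unfolding A0_of_def
proof (rule theI')
  have top: "{(A, B) \<in> complete_images H. card A = a_of H \<and> card B = b_of H}
      = {(A, B) \<in> complete_images H. card A = a_of H}"
    unfolding b_of_eq_0[OF square] by (auto dest: top_image_loopless_part_empty[OF square])
  obtain p where "{(A, B) \<in> complete_images H. card A = a_of H} = {p}"
    using n_1 unfolding n_of_def top by (rule card_1_singletonE)
  then obtain A B where AB: "{(A, B) \<in> complete_images H. card A = a_of H} = {(A, B)}"
    by (cases p) simp
  then have CI: "(A, B) \<in> complete_images H" "card A = a_of H" by blast+
  then have B: "B = {}" by (rule top_image_loopless_part_empty[OF square])
  have sub: "A \<subseteq> pverts H" using CI(1) by (simp add: complete_images_iff)
  have "(A, A) \<in> complete_bipartite_images H"
    using complete_image_imp_complete_bipartite_image[OF CI(1)] B by simp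
  then have "(A, A) \<in> {(A, B) \<in> complete_bipartite_images H. card A * card B = eta_of H}"
    using CI(2) square by (simp add: power2_eq_square)
  moreover obtain p where "{(A, B) \<in> complete_bipartite_images H. card A * card B = eta_of H} = {p}"
    using m_1 unfolding m_of_def by (rule card_1_singletonE)
  ultimately have bip:
    "{(A, B) \<in> complete_bipartite_images H. card A * card B = eta_of H} = {(A, A)}"
    by simp
  show "\<exists>!A0. A0 \<subseteq> pverts H \<and> card A0 = a_of H \<and>
     {(A, B) \<in> complete_images H. card A = a_of H} = {(A0, {})} \<and>
     {(A, B) \<in> complete_bipartite_images H. card A * card B = eta_of H} = {(A0, A0)}"
    unfolding AB bip B
  proof (rule ex1I)
    show "A \<subseteq> pverts H \<and> card A = a_of H \<and> {(A, {})} = {(A, {})} \<and> {(A, A)} = {(A, A)}"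
      using sub CI(2) by simp
  qed simp
qed

lemma A0_subset: "A0 \<subseteq> pverts H" and card_A0: "card A0 = a_of H"
  using A0_of_properties by blast+

lemma top_complete_bipartite_image:
  assumes "(A, B) \<in> complete_bipartite_images H" "card A * card B = eta_of H"
  shows "A = A0" "B = A0"
proof -
  have "(A, B) \<in> {(A, B) \<in> complete_bipartite_images H. card A * card B = eta_of H}" using assms by simp
  then show "A = A0" "B = A0" using A0_of_properties by auto
qed

lemma A0_looped:
  assumes "u \<in> A0" "v \<in> A0"
  shows "(u, v) \<in> parcs H"
proof -
  have "(A0, {}) \<in> complete_images H" using A0_of_properties by blast
  then show ?thesis using assms by (simp add: complete_images_iff)
qed

lemma finite_A0: "finite A0"
  using A0_subset finite_verts by (rule finite_subset)

lemma primed_images_subset: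
  "complete_images' H \<subseteq> complete_images H"
  "complete_bipartite_images' H \<subseteq> complete_bipartite_images H"
  by (auto simp: complete_images'_def complete_bipartite_images'_def)

lemma finite_primed_images:
  "finite {(A, B). (A, B) \<in> complete_images' H}"
  "finite {(A, B). (A, B) \<in> complete_images' H \<and> Q A B}"
  "finite {(A, B). (A, B) \<in> complete_bipartite_images' H}"
  "finite {(A, B). (A, B) \<in> complete_bipartite_images' H \<and> R A B}"
proof -
  have "finite (complete_images' H)" "finite (complete_bipartite_images' H)"
    using primed_images_subset finite_complete_images[OF finite_verts]
      finite_complete_bipartite_images[OF finite_verts] by (auto intro: finite_subset)
  then show
    "finite {(A, B). (A, B) \<in> complete_images' H}"
    "finite {(A, B). (A, B) \<in> complete_images' H \<and> Q A B}"
    "finite {(A, B). (A, B) \<in> complete_bipartite_images' H}"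
    "finite {(A, B). (A, B) \<in> complete_bipartite_images' H \<and> R A B}"
    by (auto elim: finite_subset[rotated])
qed

lemma card_le_a'_of: "(A, B) \<in> complete_images' H \<Longrightarrow> card A \<le> a'_of H"
  unfolding a'_of_def by (rule Max_insert_0_pairs_ge[OF finite_primed_images(1)])

lemma a'_of_attained:
  assumes "a'_of H > 0"
  shows "\<exists>A B. (A, B) \<in> complete_images' H \<and> card A = a'_of H"
  using assms unfolding a'_of_def by (rule Max_insert_0_pairs_attained[OF finite_primed_images(1)])

lemma card_le_b'_of:
  assumes "(A, B) \<in> complete_images' H" "card A = a'_of H"
  shows "card B \<le> b'_of H"
  unfolding b'_of_def using assms by (intro Max_insert_0_pairs_ge[OF finite_primed_images(2)] conjI)

lemma b'_of_attained:
  assumes "b'_of H > 0"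
  shows "\<exists>A B. ((A, B) \<in> complete_images' H \<and> card A = a'_of H) \<and> card B = b'_of H"
  using assms unfolding b'_of_def by (rule Max_insert_0_pairs_attained[OF finite_primed_images(2)])

lemma card_mult_le_eta'_of: "(A, B) \<in> complete_bipartite_images' H \<Longrightarrow> card A * card B \<le> eta'_of H"
  unfolding eta'_of_def by (rule Max_insert_0_pairs_ge[OF finite_primed_images(3)])

text \<open>\<open>A0\<close> induces a complete looped graph, so it omits some vertex
  \<open>v\<close>; a neighbour \<open>w\<close> of \<open>v\<close> gives the image
  \<open>({v}, {w})\<close>. With the default value 0 excluded, \<open>eta'_of H\<close> is attained
  and can serve as a denominator.\<close>

lemma eta'_of_pos: "eta'_of H > 0"
proof -
  have "pverts H \<noteq> A0"
    using not_complete_looped A0_looped by (auto simp: complete_looped_def)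
  then obtain v where v: "v \<in> pverts H" "v \<notin> A0" using A0_subset by blast
  then obtain w where "w \<in> pverts H" "(v, w) \<in> parcs H"
    using no_isolated by (auto simp: isolated_vertex_def)
  then have "({v}, {w}) \<in> complete_bipartite_images' H"
    using v by (auto simp: complete_bipartite_images'_def complete_bipartite_images_def)
  from card_mult_le_eta'_of[OF this] show ?thesis by simp
qed

lemma eta'_of_attained:
  "\<exists>A B. (A, B) \<in> complete_bipartite_images' H \<and> card A * card B = eta'_of H"
  using eta'_of_pos unfolding eta'_of_def
  by (rule Max_insert_0_pairs_attained[OF finite_primed_images(3)])

lemma m'_of_pos: "m'_of H > 0"
  unfolding m'_of_def using eta'_of_attained finite_primed_images(4)
  by (subst card_gt_0_iff) simp

text \<open>The only image of size \<open>eta_of H\<close> is \<open>(A0, A0)\<close>, which does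
  not leave \<open>A0\<close>. The strictness is what gives \<open>decay < 1\<close>.\<close>

lemma eta'_of_less: "eta'_of H < eta_of H"
proof -
  obtain A B where AB: "(A, B) \<in> complete_bipartite_images' H" "card A * card B = eta'_of H"
    using eta'_of_attained by blast
  then have CBI: "(A, B) \<in> complete_bipartite_images H" and out: "\<not> A \<subseteq> A0 \<or> \<not> B \<subseteq> A0"
    by (auto simp: complete_bipartite_images'_def)
  have "card A * card B \<noteq> eta_of H" using top_complete_bipartite_image[OF CBI] out by blast
  then show ?thesis using card_mult_le_eta_of[OF CBI] AB(2) by simp
qed

section \<open>Homomorphisms that leave \<open>A0\<close>\<close>

definition outer_complete_count :: "nat \<Rightarrow> nat" where
  "outer_complete_count n
     = card {f \<in> homs (Kcomplete n) H. Kcomplete_image H n f \<in> complete_images' H}"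

definition outer_bipartite_count :: "nat \<Rightarrow> nat" where
  "outer_bipartite_count d
     = card {f \<in> homs (Kbipartite d) H. Kbipartite_image d f \<in> complete_bipartite_images' H}"

lemma Kcomplete_image_in_complete_images'_iff:
  assumes "f \<in> homs (Kcomplete n) H" "n > card (pverts H)"
  shows "Kcomplete_image H n f \<in> complete_images' H \<longleftrightarrow> \<not> f ` {..<n} \<subseteq> A0"
proof -
  have img: "fst (Kcomplete_image H n f) \<union> snd (Kcomplete_image H n f) = f ` {..<n}"
    by (auto simp: Kcomplete_image_def)
  have "Kcomplete_image H n f \<in> complete_images' H \<longleftrightarrow>
      \<not> fst (Kcomplete_image H n f) \<union> snd (Kcomplete_image H n f) \<subseteq> A0"
    using Kcomplete_image_in_complete_images[OF finite_verts assms]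
    by (simp add: complete_images'_def case_prod_beta)
  then show ?thesis unfolding img .
qed

text \<open>The maps that are not outer have all their values in \<open>A0\<close>, where all arcs
  and loops are present; they form a full function space, which contributes no error term.\<close>

lemma hom_count_Kcomplete_split:
  assumes "n > card (pverts H)"
  shows "hom_count (Kcomplete n) H = a_of H ^ n + outer_complete_count n"
proof -
  let ?X = "{f \<in> homs (Kcomplete n) H. Kcomplete_image H n f \<in> complete_images' H}"
  have inner: "homs (Kcomplete n) H - ?X = {..<n} \<rightarrow>\<^sub>E A0"
  proof (rule set_eqI)
    fix f
    have "f \<in> homs (Kcomplete n) H \<and> f ` {..<n} \<subseteq> A0 \<longleftrightarrow> f \<in> {..<n} \<rightarrow>\<^sub>E A0"
      using A0_subset A0_looped by (auto simp: homs_Kcomplete_iff PiE_iff)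
    then show "f \<in> homs (Kcomplete n) H - ?X \<longleftrightarrow> f \<in> {..<n} \<rightarrow>\<^sub>E A0"
      using Kcomplete_image_in_complete_images'_iff[OF _ assms] by auto
  qed
  have fin: "finite (homs (Kcomplete n) H)"
    using finite_verts by (intro finite_homs) (simp_all add: Kcomplete_def)
  have "card (homs (Kcomplete n) H) = card (homs (Kcomplete n) H \<inter> ?X) + card (homs (Kcomplete n) H - ?X)"
    by (rule card_Int_Diff[OF fin])
  also have "homs (Kcomplete n) H \<inter> ?X = ?X" by blast
  finally have "card (homs (Kcomplete n) H) = card ?X + card (homs (Kcomplete n) H - ?X)" .
  then show ?thesis
    unfolding inner hom_count_eq_card_homs outer_complete_count_def
    using finite_A0 by (simp add: card_PiE card_A0)
qed

lemma hom_count_Kbipartite_split: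
  assumes "d > 0"
  shows "hom_count (Kbipartite d) H = ((a_of H)\<^sup>2) ^ d + outer_bipartite_count d"
proof -
  let ?X = "{f \<in> homs (Kbipartite d) H. Kbipartite_image d f \<in> complete_bipartite_images' H}"
  have inner: "homs (Kbipartite d) H - ?X = ({..<d} <+> {..<d}) \<rightarrow>\<^sub>E A0"
  proof (rule set_eqI)
    fix f
    have outer: "Kbipartite_image d f \<in> complete_bipartite_images' H \<longleftrightarrow>
        \<not> ((f \<circ> Inl) ` {..<d} \<subseteq> A0 \<and> (f \<circ> Inr) ` {..<d} \<subseteq> A0)" if "f \<in> homs (Kbipartite d) H"
      using Kbipartite_image_in_complete_bipartite_images[OF pseudo assms that]
      by (simp add: complete_bipartite_images'_def Kbipartite_image_def)
    have "f \<in> homs (Kbipartite d) H \<and> (f \<circ> Inl) ` {..<d} \<subseteq> A0 \<and> (f \<circ> Inr) ` {..<d} \<subseteq> A0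
        \<longleftrightarrow> f \<in> ({..<d} <+> {..<d}) \<rightarrow>\<^sub>E A0"
      using A0_subset by (auto simp: homs_Kbipartite_iff[OF pseudo] PiE_iff intro!: A0_looped)
    moreover have "f \<in> homs (Kbipartite d) H - ?X \<longleftrightarrow> f \<in> homs (Kbipartite d) H \<and>
        (f \<circ> Inl) ` {..<d} \<subseteq> A0 \<and> (f \<circ> Inr) ` {..<d} \<subseteq> A0"
      using outer by blast
    ultimately show "f \<in> homs (Kbipartite d) H - ?X \<longleftrightarrow> f \<in> ({..<d} <+> {..<d}) \<rightarrow>\<^sub>E A0"
      by (simp only:)
  qed
  have fin: "finite (homs (Kbipartite d) H)"
    using finite_verts by (intro finite_homs) (simp_all add: Kbipartite_def)
  have "card (homs (Kbipartite d) H) = card (homs (Kbipartite d) H \<inter> ?X) + card (homs (Kbipartite d) H - ?X)"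
    by (rule card_Int_Diff[OF fin])
  also have "homs (Kbipartite d) H \<inter> ?X = ?X" by blast
  finally have "card (homs (Kbipartite d) H) = card ?X + card (homs (Kbipartite d) H - ?X)" .
  then show ?thesis
    unfolding inner hom_count_eq_card_homs outer_bipartite_count_def
    using finite_A0 by (simp add: card_PiE card_A0 card_Plus mult_2 flip: power_mult)
qed

text \<open>One position \<open>i\<close> is pinned to a vertex \<open>v\<close> outside
  \<open>A0\<close>, and the other \<open>n - 1\<close> positions take arbitrary values in
  \<open>A\<close>. The image need not be \<open>(A, B)\<close>; it only has to leave
  \<open>A0\<close>, which \<open>v\<close> ensures.\<close>

lemma outer_complete_count_ge:
  assumes AB: "(A, B) \<in> complete_images' H" and n: "n > card (pverts H)"
  shows "card A ^ (n - 1) \<le> outer_complete_count n"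
    and "B \<noteq> {} \<Longrightarrow> n * card A ^ (n - 1) \<le> outer_complete_count n"
proof -
  note CI = AB[THEN subsetD[OF primed_images_subset(1)]]
  have A: "finite A" using complete_images_finite[OF CI] by blast
  have sym: "(v, u) \<in> parcs H" if "(u, v) \<in> parcs H" for u v
  proof -
    interpret pair_pseudo_graph H by (rule pseudo)
    show ?thesis using arcs_ends_symmetric[OF pair_sym_arcs] that by simp
  qed
  let ?X = "{f \<in> homs (Kcomplete n) H. Kcomplete_image H n f \<in> complete_images' H}"
  let ?F = "\<lambda>v i. PiE {..<n} (\<lambda>j. if j = i then {v} else A)"
  have finX: "finite ?X"
    using finite_homs[of "Kcomplete n" H] finite_verts by (simp add: Kcomplete_def)
  have card_F: "card (?F v i) = card A ^ (n - 1)" if "i < n" for v i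
  proof -
    have "card (?F v i) = (\<Prod>j<n. if j = i then 1 else card A)"
      by (subst card_PiE) (auto intro!: prod.cong)
    also have "\<dots> = card A ^ (n - 1)"
      using that by (simp add: prod.If_cases flip: Diff_eq)
    finally show ?thesis .
  qed
  have F_sub: "?F v i \<subseteq> ?X" if v: "v \<in> A \<union> B" "v \<notin> A0" and i: "i < n" for v i
  proof
    fix f assume f: "f \<in> ?F v i"
    have fi: "f i = v" and fj: "j < n \<Longrightarrow> j \<noteq> i \<Longrightarrow> f j \<in> A" for j
      using f i by (auto simp: PiE_iff split: if_splits)
    have adj: "(a, v) \<in> parcs H" if "a \<in> A" for a
      using CI v that by (auto simp: complete_images_iff)
    have adjA: "(a, a') \<in> parcs H" if "a \<in> A" "a' \<in> A" for a a'
      using CI that by (auto simp: complete_images_iff)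
    have "(f j, f k) \<in> parcs H" if "j < n" "k < n" "j \<noteq> k" for j k
      using that fi fj adj adjA sym by metis
    moreover have "f j \<in> pverts H" if "j < n" for j
      using that fi fj CI v by (cases "j = i") (auto simp: complete_images_iff)
    ultimately have hom: "f \<in> homs (Kcomplete n) H"
      using f by (auto simp: homs_Kcomplete_iff PiE_iff)
    then show "f \<in> ?X"
      using Kcomplete_image_in_complete_images'_iff[OF hom n] fi v(2) i by auto
  qed
  have single: "card A ^ (n - 1) \<le> outer_complete_count n" if "v \<in> A \<union> B" "v \<notin> A0" for v
  proof -
    have "0 < n" using n by simp
    then have "card (?F v 0) \<le> outer_complete_count n"
      unfolding outer_complete_count_def by (intro card_mono finX F_sub[OF that])
    then show ?thesis unfolding card_F[OF \<open>0 < n\<close>] .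
  qed
  obtain v where "v \<in> A \<union> B" "v \<notin> A0" using AB by (auto simp: complete_images'_def)
  then show "card A ^ (n - 1) \<le> outer_complete_count n" by (rule single)
  assume "B \<noteq> {}"
  then obtain b where b: "b \<in> B" by blast
  then have "(b, b) \<notin> parcs H" "b \<notin> A" using CI by (auto simp: complete_images_iff)
  \<comment> \<open>Without a loop \<open>b\<close> lies outside \<open>A0\<close>; being outside
    \<open>A\<close> as well, it occurs only at the pinned position. The families for different
    \<open>i\<close> are therefore disjoint, which yields the factor \<open>n\<close>.\<close>
  then have b': "b \<notin> A" "b \<notin> A0" using A0_looped[of b b] by blast+
  have "n * card A ^ (n - 1) = (\<Sum>i<n. card (?F b i))" using card_F by simp
  also have "\<dots> = card (\<Union>i<n. ?F b i)"
  proof (rule card_UN_disjoint[symmetric])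
    show "\<forall>i\<in>{..<n}. finite (?F b i)" using A by (auto intro!: finite_PiE)
    show "\<forall>i\<in>{..<n}. \<forall>j\<in>{..<n}. i \<noteq> j \<longrightarrow> ?F b i \<inter> ?F b j = {}"
    proof (intro ballI impI)
      fix i j assume ij: "i \<in> {..<n}" "j \<in> {..<n}" "i \<noteq> j"
      have "False" if "f \<in> ?F b i" "f \<in> ?F b j" for f
      proof -
        have "f i = b" using PiE_mem[OF that(1) ij(1)] by simp
        moreover have "f i \<in> A" using PiE_mem[OF that(2) ij(1)] ij(3) by simp
        ultimately show False using b' by simp
      qed
      then show "?F b i \<inter> ?F b j = {}" by blast
    qed
  qed simp
  also have "\<dots> \<le> outer_complete_count n"
    unfolding outer_complete_count_def using F_sub[of b] b b' finX by (intro card_mono) auto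
  finally show "n * card A ^ (n - 1) \<le> outer_complete_count n" .
qed

text \<open>
  Dividing both excesses by \<open>decay ^ d\<close> turns the two outer counts into sequences with finite
  limits when \<open>a_of H * a'_of H = eta'_of H\<close> and \<open>b'_of H = 0\<close>. The factor \<open>decay\<close> in \<open>scaled_complete\<close> compensates for its
  argument, which is the number \<open>d + 1\<close> of vertices.
\<close>

definition decay :: real where
  "decay = real (eta'_of H) / (real (a_of H))\<^sup>2"

definition scaled_complete :: "nat \<Rightarrow> real" where
  "scaled_complete n = decay * (real (outer_complete_count n) / (real (a_of H) * decay) ^ n)"

definition scaled_bipartite :: "nat \<Rightarrow> real" where
  "scaled_bipartite d = real (outer_bipartite_count d) / real (eta'_of H) ^ d"

lemma decay_bounds: "0 < decay" "decay < 1"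
proof -
  have "real (eta'_of H) < (real (a_of H))\<^sup>2"
    using eta'_of_less by (simp flip: square)
  then show "0 < decay" "decay < 1" using eta'_of_pos a_of_pos by (auto simp: decay_def)
qed

lemma a_of_decay: "real (a_of H) * decay = real (eta'_of H) / real (a_of H)"
  using a_of_pos by (simp add: decay_def power2_eq_square)

lemma rapidly_tends_scaled_bipartite: "rapidly_tends scaled_bipartite (real (m'_of H))"
  unfolding scaled_bipartite_def[abs_def] outer_bipartite_count_def m'_of_def
  using primed_images_subset card_mult_le_eta'_of eta'_of_pos
  by (intro rapidly_tends_card_homs_Kbipartite[OF pseudo]) auto

lemma rapidly_tends_scaled_bipartite_excess:
  "rapidly_tends (\<lambda>d. ln (1 + scaled_bipartite d * decay ^ d) / decay ^ d / 2) (real (m'_of H) / 2)"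
  using rapidly_tends_cmult[OF rapidly_tends_ln_one_plus[OF rapidly_tends_scaled_bipartite decay_bounds],
      of "1 / 2"] by (simp add: mult.commute)

lemma bipartite_excess_eq:
  assumes "d > 0"
  shows "bipartite_excess d / real d
    = decay ^ d * (ln (1 + scaled_bipartite d * decay ^ d) / decay ^ d / 2 / real d)"
proof -
  have "real (hom_count (Kbipartite d) H) / ((real (a_of H))\<^sup>2) ^ d = 1 + scaled_bipartite d * decay ^ d"
    using a_of_pos eta'_of_pos unfolding hom_count_Kbipartite_split[OF assms]
    by (simp add: scaled_bipartite_def decay_def power_divide add_divide_distrib)
  then show ?thesis using decay_bounds by (simp add: bipartite_excess_def)
qed

lemma complete_excess_eq:
  assumes "d \<ge> card (pverts H)"
  shows "complete_excess (Suc d) / real (d + 1)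
    = decay ^ d * (ln (1 + scaled_complete (Suc d) * decay ^ d) / decay ^ d / real (d + 1))"
proof -
  have "real (hom_count (Kcomplete (Suc d)) H) / real (a_of H) ^ Suc d
      = 1 + scaled_complete (Suc d) * decay ^ d"
    using a_of_pos decay_bounds assms hom_count_Kcomplete_split[of "Suc d"]
    by (simp add: scaled_complete_def power_mult_distrib add_divide_distrib)
  then show ?thesis using decay_bounds by (simp add: complete_excess_def)
qed

section \<open>Comparison of the outer contributions\<close>

text \<open>Both excesses share the positive factor \<open>decay ^ d\<close>, so the rescaled
  sequences decide. Positivity of \<open>m'_of H\<close> settles the tie c = m'/2.\<close>

lemma complete_bipartite_type_of_scaled:
  assumes "rapidly_tends scaled_complete c" "c \<le> real (m'_of H) / 2"
  shows "complete_bipartite_type H"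
proof (rule complete_bipartite_typeI)
  have "\<forall>\<^sub>F d in sequentially.
      ln (1 + scaled_complete (Suc d) * decay ^ d) / decay ^ d / real (d + 1)
      < ln (1 + scaled_bipartite d * decay ^ d) / decay ^ d / 2 / real d"
    using m'_of_pos
    by (intro eventually_less_of_rapidly_tends[OF _ _ assms(2)] rapidly_tends_ln_one_plus
          decay_bounds rapidly_tends_Suc assms(1) rapidly_tends_scaled_bipartite_excess) simp
  then show "\<forall>\<^sub>F d in sequentially. complete_excess (Suc d) / real (d + 1) < bipartite_excess d / real d"
    using eventually_gt_at_top[of 0] eventually_ge_at_top[of "card (pverts H)"]
    by eventually_elim
      (simp only: complete_excess_eq bipartite_excess_eq mult_strict_left_mono zero_less_power decay_bounds)
qed

text \<open>A minorant \<open>X\<close> stands in for \<open>scaled_complete\<close>, which has no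
  finite limit when a a' > \<eta>', or when a a' = \<eta>' and b' > 0; monotonicity of
  \<open>ln\<close> transfers the inequality.\<close>

lemma complete_type_of_scaled:
  assumes X: "rapidly_tends X c" "real (m'_of H) / 2 < c"
    and le: "\<forall>\<^sub>F d in sequentially. 0 \<le> X d \<and> X d \<le> scaled_complete (Suc d)"
  shows "complete_type H"
proof (rule complete_typeI)
  have "\<forall>\<^sub>F d in sequentially.
      ln (1 + scaled_bipartite d * decay ^ d) / decay ^ d / 2 / real d
      < ln (1 + X d * decay ^ d) / decay ^ d / real (d + 1)"
    by (intro eventually_greater_of_rapidly_tends[OF _ _ X(2)] rapidly_tends_ln_one_plus
          decay_bounds X(1) rapidly_tends_scaled_bipartite_excess)
  then show "\<forall>\<^sub>F d in sequentially. bipartite_excess d / real d < complete_excess (Suc d) / real (d + 1)"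
    using le eventually_gt_at_top[of 0] eventually_ge_at_top[of "card (pverts H)"]
  proof eventually_elim
    case (elim d)
    have r: "decay ^ d > 0" using decay_bounds by simp
    have "X d * decay ^ d \<le> scaled_complete (Suc d) * decay ^ d"
      using elim r by (intro mult_right_mono) auto
    moreover have "0 \<le> X d * decay ^ d" using elim r by simp
    ultimately have "ln (1 + X d * decay ^ d) \<le> ln (1 + scaled_complete (Suc d) * decay ^ d)" by simp
    then have "ln (1 + X d * decay ^ d) / decay ^ d / real (d + 1)
        \<le> ln (1 + scaled_complete (Suc d) * decay ^ d) / decay ^ d / real (d + 1)"
      using r by (intro divide_right_mono) auto
    then have "ln (1 + scaled_bipartite d * decay ^ d) / decay ^ d / 2 / real d
        < ln (1 + scaled_complete (Suc d) * decay ^ d) / decay ^ d / real (d + 1)"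
      using elim(1) by linarith
    then show ?case
      unfolding complete_excess_eq[OF elim(4)] bipartite_excess_eq[OF elim(3)]
      using r by (rule mult_strict_left_mono)
  qed
qed

lemma complete_type_of_unbounded:
  assumes "\<forall>\<^sub>F d in sequentially. real (m'_of H) + 1 \<le> scaled_complete (Suc d)"
  shows "complete_type H"
proof (rule complete_type_of_scaled)
  show "rapidly_tends (\<lambda>_. real (m'_of H) + 1) (real (m'_of H) + 1)" by (simp add: rapidly_tends_def)
  show "\<forall>\<^sub>F d in sequentially. 0 \<le> real (m'_of H) + 1 \<and> real (m'_of H) + 1 \<le> scaled_complete (Suc d)"
    using assms by eventually_elim simp
qed simp

text \<open>Since a * decay = \<eta>'/a, a lower bound k a'^d becomes k (a a'/\<eta>')^d, up to the
  factor 1/a left by the shift to \<open>Suc d\<close>. It is used with \<open>k = 1\<close>, where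
  the power grows, and with \<open>k = Suc d\<close>, where the power is 1.\<close>

lemma scaled_complete_Suc_ge:
  assumes "real k * real (a'_of H) ^ d \<le> real (outer_complete_count (Suc d))"
  shows "real k * (real (a_of H * a'_of H) / real (eta'_of H)) ^ d / real (a_of H) \<le> scaled_complete (Suc d)"
proof -
  have "real k * (real (a_of H * a'_of H) / real (eta'_of H)) ^ d / real (a_of H)
      = decay * (real k * real (a'_of H) ^ d / (real (a_of H) * decay) ^ Suc d)"
    using a_of_pos eta'_of_pos unfolding power_Suc a_of_decay
    by (simp add: decay_def power_divide power_mult_distrib power2_eq_square mult_ac)
  also have "\<dots> \<le> scaled_complete (Suc d)"
    unfolding scaled_complete_def using decay_bounds(1) a_of_pos assms
    by (intro mult_left_mono divide_right_mono) auto
  finally show ?thesis .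
qed

text \<open>The ratio \<open>?\<rho>\<close> equals a a'/\<eta>' < 1, so even with a polynomial
  factor the outer complete maps vanish after rescaling, and the limit 0 is at most m'/2. The case
  \<open>a'_of H = 0\<close>, without any such complete image, is included.\<close>

lemma complete_bipartite_type_of_product_less:
  assumes "a_of H * a'_of H < eta'_of H"
  shows "complete_bipartite_type H"
proof (rule complete_bipartite_type_of_scaled)
  let ?q = "card (pverts H)" and ?K = "real (card (complete_images' H))"
  let ?\<rho> = "real (a'_of H) / (real (a_of H) * decay)"
  have lt: "real (a'_of H) < real (a_of H) * decay"
    using assms a_of_pos unfolding a_of_decay by (simp add: pos_less_divide_eq mult.commute flip: of_nat_mult)
  then have pos: "real (a_of H) * decay > 0" by linarith
  show "rapidly_tends scaled_complete 0"
  proof (rule rapidly_tendsI_geometric[where k = ?q and \<rho> = ?\<rho> and K = "decay * ?K"])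
    show "\<forall>\<^sub>F n in sequentially. \<bar>scaled_complete n - 0\<bar> \<le> decay * ?K * (real n ^ ?q * ?\<rho> ^ n)"
      using eventually_gt_at_top[of 0]
    proof eventually_elim
      case (elim n)
      have "outer_complete_count n \<le> card (complete_images' H) * (n ^ ?q * a'_of H ^ n)"
        unfolding outer_complete_count_def using primed_images_subset card_le_a'_of elim
        by (intro card_homs_Kcomplete_le[OF finite_verts]) auto
      then have "real (outer_complete_count n) \<le> ?K * (real n ^ ?q * real (a'_of H) ^ n)"
        by (simp only: of_nat_le_iff flip: of_nat_mult of_nat_power)
      then have "real (outer_complete_count n) / (real (a_of H) * decay) ^ n
          \<le> ?K * (real n ^ ?q * real (a'_of H) ^ n) / (real (a_of H) * decay) ^ n"
        using pos by (intro divide_right_mono) auto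
      then have "scaled_complete n
          \<le> decay * (?K * (real n ^ ?q * real (a'_of H) ^ n) / (real (a_of H) * decay) ^ n)"
        unfolding scaled_complete_def using decay_bounds by (intro mult_left_mono) auto
      moreover have "scaled_complete n \<ge> 0"
        unfolding scaled_complete_def using decay_bounds by simp
      ultimately show ?case by (simp add: power_divide mult_ac)
    qed
    show "0 \<le> ?\<rho>" "?\<rho> < 1" using lt pos by auto
  qed
qed simp

lemma complete_type_of_product_greater:
  assumes "a_of H * a'_of H > eta'_of H"
  shows "complete_type H"
proof (rule complete_type_of_unbounded)
  let ?\<rho> = "real (a_of H * a'_of H) / real (eta'_of H)"
  \<comment> \<open>The strict inequality excludes the default value 0, so \<open>a'_of H\<close> is
    attained by an image.\<close>
  have "a'_of H > 0" using assms by (cases "a'_of H = 0") auto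
  then obtain A B where AB: "(A, B) \<in> complete_images' H" "card A = a'_of H"
    using a'_of_attained by blast
  have exp_at_top: "filterlim (\<lambda>d. \<rho> ^ d) at_top sequentially" if "\<rho> > 1" for \<rho> :: real
    using that by real_asymp
  have "?\<rho> > 1" using assms eta'_of_pos by (simp del: of_nat_mult)
  then have "filterlim (\<lambda>d. ?\<rho> ^ d) at_top sequentially"
    by (rule exp_at_top)
  then have "\<forall>\<^sub>F d in sequentially. ?\<rho> ^ d \<ge> real (a_of H) * (real (m'_of H) + 1)"
    by (simp add: filterlim_at_top)
  then show "\<forall>\<^sub>F d in sequentially. real (m'_of H) + 1 \<le> scaled_complete (Suc d)"
    using eventually_ge_at_top[of "card (pverts H)"]
  proof eventually_elim
    case (elim d)
    have "real (a'_of H ^ d) \<le> real (outer_complete_count (Suc d))"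
      using outer_complete_count_ge(1)[OF AB(1), of "Suc d"] AB(2) elim unfolding of_nat_le_iff by simp
    then have "?\<rho> ^ d / real (a_of H) \<le> scaled_complete (Suc d)"
      using scaled_complete_Suc_ge[of 1 d] by simp
    moreover have "real (m'_of H) + 1 \<le> ?\<rho> ^ d / real (a_of H)"
      using elim(1) a_of_pos by (simp add: pos_le_divide_eq mult.commute del: of_nat_mult)
    ultimately show ?case by linarith
  qed
qed

text \<open>The power in the lower bound is 1, but the position of a loopless vertex supplies the
  factor \<open>Suc d\<close>, so \<open>scaled_complete (Suc d)\<close> is at least (d +
  1)/a.\<close>

lemma complete_type_of_b'_pos:
  assumes "a_of H * a'_of H = eta'_of H" "b'_of H > 0"
  shows "complete_type H"
proof (rule complete_type_of_unbounded)
  obtain A B where AB: "(A, B) \<in> complete_images' H" "card A = a'_of H" "card B = b'_of H"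
    using b'_of_attained[OF assms(2)] by blast
  have "B \<noteq> {}" using AB(3) assms(2) by auto
  show "\<forall>\<^sub>F d in sequentially. real (m'_of H) + 1 \<le> scaled_complete (Suc d)"
    using eventually_ge_at_top[of "card (pverts H)"]
      eventually_ge_at_top[of "a_of H * (m'_of H + 1)"]
  proof eventually_elim
    case (elim d)
    have "Suc d > card (pverts H)" using elim by simp
    from outer_complete_count_ge(2)[OF AB(1) this \<open>B \<noteq> {}\<close>]
    have "Suc d * a'_of H ^ d \<le> outer_complete_count (Suc d)" unfolding AB(2) by simp
    then have "real (Suc d) * real (a'_of H) ^ d \<le> real (outer_complete_count (Suc d))"
      by (simp only: of_nat_le_iff flip: of_nat_mult of_nat_power)
    from scaled_complete_Suc_ge[OF this]
    have "real (Suc d) / real (a_of H) \<le> scaled_complete (Suc d)"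
      unfolding assms(1) using eta'_of_pos by simp
    moreover have "real (a_of H * (m'_of H + 1)) \<le> real (Suc d)"
      unfolding of_nat_le_iff using elim by simp
    then have "real (m'_of H) + 1 \<le> real (Suc d) / real (a_of H)"
      using a_of_pos by (simp add: pos_le_divide_eq algebra_simps)
    ultimately show ?case by linarith
  qed
qed

text \<open>From a a' = \<eta>' follow decay = a'/a and a * decay = a', so
  \<open>scaled_complete n\<close> is \<open>decay\<close> times the outer count over
  \<open>a' ^ n\<close>. As b' = 0, images of primary size a' have no loopless part and cause no
  polynomial factor, and the quotient tends to n'.\<close>

lemma rapidly_tends_scaled_complete:
  assumes "a_of H * a'_of H = eta'_of H" "b'_of H = 0"
  shows "rapidly_tends scaled_complete (real (a'_of H) / real (a_of H) * real (n'_of H))"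
proof -
  have a': "a'_of H > 0" using assms(1) eta'_of_pos by (cases "a'_of H = 0") auto
  have r: "decay = real (a'_of H) / real (a_of H)"
    using a_of_pos unfolding decay_def assms(1)[symmetric] by (simp add: power2_eq_square)
  then have ar: "real (a_of H) * decay = real (a'_of H)" using a_of_pos by simp
  have top: "B = {}" if "(A, B) \<in> complete_images' H" "card A = a'_of H" for A B
    using card_le_b'_of[OF that] assms(2) complete_images_finite(2)[of A B] that primed_images_subset by auto
  have "n'_of H = card {(A, B) \<in> complete_images' H. card A = a'_of H}"
    unfolding n'_of_def assms(2) by (intro arg_cong[where f = card]) (auto dest: top)
  moreover have "rapidly_tends (\<lambda>n. real (outer_complete_count n) / real (a'_of H) ^ n)
      (real (card {(A, B) \<in> complete_images' H. card A = a'_of H}))"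
    unfolding outer_complete_count_def
  proof (rule rapidly_tends_card_homs_Kcomplete[OF finite_verts primed_images_subset(1) _ a'])
    show "\<forall>(A, B)\<in>complete_images' H. card A \<le> a'_of H" using card_le_a'_of by auto
    show "\<forall>(A, B)\<in>complete_images' H. card A = a'_of H \<longrightarrow> B = {}" using top by fast
  qed
  ultimately have "rapidly_tends (\<lambda>n. real (outer_complete_count n) / real (a'_of H) ^ n) (real (n'_of H))"
    by simp
  from rapidly_tends_cmult[OF this, of decay] show ?thesis
    unfolding scaled_complete_def[abs_def] ar r[symmetric] .
qed

lemma complete_bipartite_type_of_count_le:
  assumes "a_of H * a'_of H = eta'_of H" "b'_of H = 0"
    and "2 * n'_of H * a'_of H \<le> a_of H * m'_of H"
  shows "complete_bipartite_type H"
proof (rule complete_bipartite_type_of_scaled[OF rapidly_tends_scaled_complete[OF assms(1,2)]])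
  have "real (2 * n'_of H * a'_of H) \<le> real (a_of H * m'_of H)" using assms(3) by (simp only: of_nat_le_iff)
  then show "real (a'_of H) / real (a_of H) * real (n'_of H) \<le> real (m'_of H) / 2"
    using a_of_pos by (simp add: field_simps)
qed

lemma complete_type_of_count_greater:
  assumes "a_of H * a'_of H = eta'_of H" "b'_of H = 0"
    and "2 * n'_of H * a'_of H > a_of H * m'_of H"
  shows "complete_type H"
proof (rule complete_type_of_scaled[OF rapidly_tends_Suc[OF rapidly_tends_scaled_complete[OF assms(1,2)]]])
  have "real (2 * n'_of H * a'_of H) > real (a_of H * m'_of H)" using assms(3) by (simp only: of_nat_less_iff)
  then show "real (m'_of H) / 2 < real (a'_of H) / real (a_of H) * real (n'_of H)"
    using a_of_pos by (simp add: field_simps)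
  show "\<forall>\<^sub>F d in sequentially. 0 \<le> scaled_complete (Suc d) \<and> scaled_complete (Suc d) \<le> scaled_complete (Suc d)"
    using decay_bounds by (simp add: scaled_complete_def)
qed

end

section \<open>Loopless targets and the final case distinction\<close>

text \<open>By pigeonhole a homomorphism from \<open>Kcomplete (d + 1)\<close> would force a loop
  once \<open>d \<ge> card (pverts H)\<close>, so that root is 0. Sending the two classes to the
  ends of one edge makes the bipartite root positive.\<close>

lemma complete_bipartite_type_of_loopless:
  assumes H: "pair_pseudo_graph H" and "\<not> (\<exists>v. isolated_vertex H v)"
    and "\<not> complete_looped (with_proj H)" and "\<not> has_loop H"
  shows "complete_bipartite_type H"
  unfolding complete_bipartite_type_iff_eventually
  using eventually_ge_at_top[of "card (pverts H)"] eventually_gt_at_top[of 0]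
proof eventually_elim
  case (elim d)
  interpret pair_pseudo_graph H by fact
  have "complete_images H = {}"
    using assms(4) by (auto simp: complete_images_iff has_loop_def) blast
  then have "homs (Kcomplete (d + 1)) H = {}"
    using Kcomplete_image_in_complete_images[OF pair_finite_verts, of _ "d + 1"] elim by auto
  \<comment> \<open>The graph without vertices counts as complete looped, so a vertex
    exists.\<close>
  moreover obtain v where "v \<in> pverts H"
    using assms(3) by (auto simp: complete_looped_def)
  then obtain w where vw: "v \<in> pverts H" "w \<in> pverts H" "(v, w) \<in> parcs H"
    using assms(2) by (auto simp: isolated_vertex_def)
  have "(\<lambda>x\<in>{..<d} <+> {..<d}. case x of Inl _ \<Rightarrow> v | Inr _ \<Rightarrow> w) \<in> homs (Kbipartite d) H"
    unfolding homs_Kbipartite_iff[OF H] using vw by auto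
  then have "card (homs (Kbipartite d) H) > 0"
    using finite_homs[of "Kbipartite d" H] pair_finite_verts by (auto simp: card_gt_0_iff Kbipartite_def)
  ultimately show ?case by (simp add: hom_count_eq_card_homs)
qed

theorem theorem4p1:
  fixes H :: "'a pair_pre_digraph"
  assumes "pair_pseudo_graph H"
    and "\<not> (\<exists>v. isolated_vertex H v)"
    and "\<not> complete_looped (with_proj H)"
  shows "(complete_bipartite_type H \<or> complete_type H) \<and>
         \<not> (complete_bipartite_type H \<and> complete_type H) \<and>
    (complete_bipartite_type H \<longleftrightarrow>
       \<not> has_loop H \<or>
       (has_loop H \<and>
         ((a_of H)\<^sup>2 < eta_of H \<or>
          ((a_of H)\<^sup>2 = eta_of H \<and> m_of H > 1 \<and> m_of H \<ge> (n_of H)\<^sup>2) \<or>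
          ((a_of H)\<^sup>2 = eta_of H \<and> m_of H = 1 \<and> n_of H = 1 \<and>
             a_of H * a'_of H < eta'_of H) \<or>
          ((a_of H)\<^sup>2 = eta_of H \<and> m_of H = 1 \<and> n_of H = 1 \<and>
             a_of H * a'_of H = eta'_of H \<and> b'_of H = 0 \<and>
             2 * n'_of H * a'_of H \<le> a_of H * m'_of H \<and> m'_of H > 0)))) \<and>
    (complete_type H \<longleftrightarrow>
       has_loop H \<and>
         (((a_of H)\<^sup>2 = eta_of H \<and> m_of H < (n_of H)\<^sup>2) \<or>
          ((a_of H)\<^sup>2 = eta_of H \<and> m_of H = 1 \<and> n_of H = 1 \<and>
             a_of H * a'_of H > eta'_of H) \<or>
          ((a_of H)\<^sup>2 = eta_of H \<and> m_of H = 1 \<and> n_of H = 1 \<and>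
             a_of H * a'_of H = eta'_of H \<and> b'_of H > 0) \<or>
          ((a_of H)\<^sup>2 = eta_of H \<and> m_of H = 1 \<and> n_of H = 1 \<and>
             a_of H * a'_of H = eta'_of H \<and> b'_of H = 0 \<and>
             2 * n'_of H * a'_of H > a_of H * m'_of H)))"
proof (cases "has_loop H")
  case False
  with assms have "complete_bipartite_type H" by (intro complete_bipartite_type_of_loopless)
  with False not_both_types[of H] show ?thesis by blast
next
  case True
  interpret looped_pseudo_graph H
    by (rule looped_pseudo_graph.intro[OF assms(1) True])
  have unique: "uniquely_dominated_graph H"
    if "(a_of H)\<^sup>2 = eta_of H" "m_of H = 1" "n_of H = 1"
    by (intro uniquely_dominated_graph.intro uniquely_dominated_graph_axioms.intro
        looped_pseudo_graph_axioms that assms)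
  note bipartite = complete_bipartite_type_of_square_less complete_bipartite_type_of_m_ge
    uniquely_dominated_graph.complete_bipartite_type_of_product_less[OF unique]
    uniquely_dominated_graph.complete_bipartite_type_of_count_le[OF unique]
  note complete = complete_type_of_m_less
    uniquely_dominated_graph.complete_type_of_product_greater[OF unique]
    uniquely_dominated_graph.complete_type_of_b'_pos[OF unique]
    uniquely_dominated_graph.complete_type_of_count_greater[OF unique]
  let ?sq = "(a_of H)\<^sup>2 = eta_of H" and ?prod = "a_of H * a'_of H"
  let ?B = "(a_of H)\<^sup>2 < eta_of H \<or> (?sq \<and> m_of H > 1 \<and> m_of H \<ge> (n_of H)\<^sup>2) \<or>
      (?sq \<and> m_of H = 1 \<and> n_of H = 1 \<and> ?prod < eta'_of H) \<or>
      (?sq \<and> m_of H = 1 \<and> n_of H = 1 \<and> ?prod = eta'_of H \<and> b'_of H = 0 \<and>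
        2 * n'_of H * a'_of H \<le> a_of H * m'_of H \<and> m'_of H > 0)"
  let ?C = "(?sq \<and> m_of H < (n_of H)\<^sup>2) \<or>
      (?sq \<and> m_of H = 1 \<and> n_of H = 1 \<and> ?prod > eta'_of H) \<or>
      (?sq \<and> m_of H = 1 \<and> n_of H = 1 \<and> ?prod = eta'_of H \<and> b'_of H > 0) \<or>
      (?sq \<and> m_of H = 1 \<and> n_of H = 1 \<and> ?prod = eta'_of H \<and> b'_of H = 0 \<and>
        2 * n'_of H * a'_of H > a_of H * m'_of H)"
  have B: "?B \<Longrightarrow> complete_bipartite_type H" using bipartite by blast
  have C: "?C \<Longrightarrow> complete_type H" using complete by blast
  have m': "m'_of H > 0" if ?sq "m_of H = 1" "n_of H = 1"
    by (rule uniquely_dominated_graph.m'_of_pos[OF unique[OF that]])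
  \<comment> \<open>If a^2 = \<eta> and n^2 \<le> m, the conditions on m leave only m = 1, which
    forces n = 1; there the secondary parameters are compared, and \<open>m'\<close> supplies the
    conjunct \<open>m'_of H > 0\<close>.\<close>
  have BC: "?B \<or> ?C"
  proof (cases "?sq \<and> m_of H \<ge> (n_of H)\<^sup>2")
    case False
    then have "(a_of H)\<^sup>2 < eta_of H \<or> (?sq \<and> m_of H < (n_of H)\<^sup>2)"
      using a_of_square_le_eta_of by (metis le_neq_implies_less not_le)
    then show ?thesis by blast
  next
    case sq: True
    show ?thesis
    proof (cases "m_of H > 1")
      case False
      then have m1: "m_of H = 1" using m_of_pos by simp
      then have "n_of H ^ 2 \<le> 1 ^ 2" using sq by simp
      then have "n_of H \<le> 1" by (rule power2_le_imp_le) simp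
      then have n1: "n_of H = 1" using n_of_pos by simp
      have "x < y \<or> y < x \<or> x = y \<and> b > 0 \<or> x = y \<and> b = 0 \<and> p \<le> q \<or> x = y \<and> b = 0 \<and> q < p"
        for x y b p q :: nat by linarith
      from this[of ?prod "eta'_of H" "b'_of H" "2 * n'_of H * a'_of H" "a_of H * m'_of H"]
      show ?thesis using sq m1 n1 m' by blast
    qed (use sq in blast)
  qed
  \<comment> \<open>Each condition has been shown sufficient only. As the conditions exhaust all
    cases and the two types exclude each other, necessity follows propositionally.\<close>
  have "(X \<or> Y) \<and> \<not> (X \<and> Y) \<and> (X \<longleftrightarrow> \<not> L \<or> L \<and> P) \<and> (Y \<longleftrightarrow> L \<and> Q)"
    if "P \<Longrightarrow> X" "Q \<Longrightarrow> Y" "P \<or> Q" "\<not> (X \<and> Y)" L for X Y L P Q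
    using that by blast
  from this[OF B C BC not_both_types True] show ?thesis .
qed

end
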